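(* Let $G$ be a profinite group and let $\{L_i\}_{i\in I}$ be a finite family of lattices with $|L_i|\geq 2$ for all $i\in I$. The following statements are equivalent: (1) $\mathcal{L}_o(G)\simeq\operatorname{Cr}_{i\in I}L_i$; (2) $G\simeq\operatorname{Cr}_{i\in I}G_i$, where $G_i$ is a profinite group with $\mathcal{L}_o(G_i)\simeq L_i$ for every $i\in I$, and $\pi^\star(G_i)\cap\pi^\star(G_j)=\emptyset$ for every $i,j\in I$ with $i\neq j$.
   Context: For a profinite group $G$, $\mathcal{L}_o(G)$ is the lattice of all open subgroups of $G$, with meet the intersection and join $\langle X,Y\rangle$. $\pi^\star(G)$ is the set of all primes $p$ for which $G$ has a non-trivial procyclic pro-$p$ subgroup. $\operatorname{Cr}$ denotes the (unrestricted) direct product: of lattices with componentwise operations, and of profinite groups with the product topology. Isomorphisms of profinite groups are isomorphisms of topological groups. *)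

theory Defs
  imports "HOL-Analysis.Analysis" "HOL-Algebra.Product_Groups" "HOL-Algebra.Lattice"
    "HOL-Algebra.Generated_Groups" "HOL-Computational_Algebra.Primes"
begin

section \<open>Profinite groups\<close>

locale topological_group = group G for G (structure) +
  fixes T :: "'a topology"
  assumes topspace_eq: "topspace T = carrier G"
    and continuous_mult: "continuous_map (prod_topology T T) T (\<lambda>(x, y). x \<otimes> y)"
    and continuous_inv: "continuous_map T T (\<lambda>x. inv x)"

definition totally_disconnected_space :: "'a topology \<Rightarrow> bool" where
  "totally_disconnected_space T \<longleftrightarrow> (\<forall>C. connectedin T C \<longrightarrow> (\<exists>x. C \<subseteq> {x}))"

locale profinite_group = topological_group +
  assumes compact: "compact_space T"
    and Hausdorff: "Hausdorff_space T"
    and totally_disconnected: "totally_disconnected_space T"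

definition topological_group_iso ::
    "('a, 'm) monoid_scheme \<Rightarrow> 'a topology \<Rightarrow> ('b, 'n) monoid_scheme \<Rightarrow> 'b topology \<Rightarrow> bool" where
  "topological_group_iso G T H U \<longleftrightarrow> (\<exists>f. f \<in> iso G H \<and> homeomorphic_map T U f)"

locale procyclic_group = profinite_group +
  assumes topologically_cyclic: "\<exists>x\<in>carrier G. T closure_of (generate G {x}) = carrier G"

locale pro_p_group = profinite_group +
  fixes p :: nat
  assumes index_power: "\<And>N. N \<lhd> G \<Longrightarrow> openin T N \<Longrightarrow> \<exists>k. card (rcosets N) = p ^ k"

text \<open>Subgroups of a profinite group in the sense of profinite groups are the closed ones.\<close>

definition pi_star :: "('a, 'm) monoid_scheme \<Rightarrow> 'a topology \<Rightarrow> nat set" where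
  "pi_star G T = {p. prime p \<and>
     (\<exists>H. subgroup H G \<and> closedin T H \<and> H \<noteq> {\<one>\<^bsub>G\<^esub>} \<and>
          procyclic_group (G\<lparr>carrier := H\<rparr>) (subtopology T H) \<and>
          pro_p_group (G\<lparr>carrier := H\<rparr>) (subtopology T H) p)}"


section \<open>Lattices\<close>

definition open_subgroup_lattice :: "('a, 'm) monoid_scheme \<Rightarrow> 'a topology \<Rightarrow> 'a set gorder" where
  "open_subgroup_lattice G T =
     \<lparr>carrier = {H. subgroup H G \<and> openin T H}, eq = (=), le = (\<subseteq>)\<rparr>"

text \<open>The order of a direct product of lattices is componentwise; that its joins and meets are
  the componentwise ones is shown in \<open>join_product_lattice\<close> and \<open>meet_product_lattice\<close>.\<close>

definition product_lattice :: "'i set \<Rightarrow> ('i \<Rightarrow> ('b, 'm) gorder_scheme) \<Rightarrow> ('i \<Rightarrow> 'b) gorder" where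
  "product_lattice I L =
     \<lparr>carrier = (\<Pi>\<^sub>E i\<in>I. carrier (L i)), eq = (=), le = (\<lambda>x y. \<forall>i\<in>I. x i \<sqsubseteq>\<^bsub>L i\<^esub> y i)\<rparr>"

definition lattice_iso :: "('a, 'm) gorder_scheme \<Rightarrow> ('b, 'n) gorder_scheme \<Rightarrow> bool" where
  "lattice_iso L M \<longleftrightarrow>
     (\<exists>f. bij_betw f (carrier L) (carrier M) \<and> join_pres L M f \<and> meet_pres L M f)"


section \<open>The lattice operations\<close>

lemma lattice_from_bounds:
  fixes L (structure)
  assumes po: "partial_order L"
    and j: "\<And>x y. x \<in> carrier L \<Longrightarrow> y \<in> carrier L \<Longrightarrow> least L (j x y) (Upper L {x, y})"
    and m: "\<And>x y. x \<in> carrier L \<Longrightarrow> y \<in> carrier L \<Longrightarrow> greatest L (m x y) (Lower L {x, y})"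
  shows "lattice L"
    and "\<And>x y. x \<in> carrier L \<Longrightarrow> y \<in> carrier L \<Longrightarrow> x \<squnion> y = j x y"
    and "\<And>x y. x \<in> carrier L \<Longrightarrow> y \<in> carrier L \<Longrightarrow> x \<sqinter> y = m x y"
proof -
  interpret partial_order L by (rule po)
  show "lattice L"
    by (unfold_locales; use j m in blast)
  show "x \<squnion> y = j x y" if "x \<in> carrier L" "y \<in> carrier L" for x y
    unfolding join_def sup_def using j[OF that] by (blast intro: someI2 least_unique)
  show "x \<sqinter> y = m x y" if "x \<in> carrier L" "y \<in> carrier L" for x y
    unfolding meet_def inf_def using m[OF that] by (blast intro: someI2 greatest_unique)
qed

context topological_group
begin

lemma continuous_left_translation:
  assumes "a \<in> carrier G" shows "continuous_map T T (\<lambda>x. a \<otimes> x)"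
proof -
  have "continuous_map T (prod_topology T T) (\<lambda>x. (a, x))"
    using assms by (simp add: continuous_map_pairwise o_def topspace_eq)
  from continuous_map_compose[OF this continuous_mult] show ?thesis by (simp add: o_def)
qed

lemma openin_subgroup_mono:
  assumes H: "subgroup H G" "openin T H" and K: "subgroup K G" and HK: "H \<subseteq> K"
  shows "openin T K"
proof (subst openin_subopen, intro ballI)
  fix k assume k: "k \<in> K"
  have kc: "k \<in> carrier G" using k K subgroup.subset by blast
  let ?V = "{x \<in> topspace T. inv k \<otimes> x \<in> H}"
  have "openin T ?V"
    by (rule openin_continuous_map_preimage[OF continuous_left_translation H(2)]) (use kc in simp)
  moreover have "k \<in> ?V" using kc H(1) by (simp add: topspace_eq subgroup.one_closed)
  moreover have "?V \<subseteq> K"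
  proof
    fix x assume "x \<in> ?V"
    then have x: "x \<in> carrier G" "inv k \<otimes> x \<in> K" using HK by (auto simp: topspace_eq)
    have "x = k \<otimes> (inv k \<otimes> x)" using x kc by (simp add: m_assoc[symmetric])
    also have "\<dots> \<in> K" using K k x by (simp add: subgroup.m_closed)
    finally show "x \<in> K" .
  qed
  ultimately show "\<exists>V. openin T V \<and> k \<in> V \<and> V \<subseteq> K" by blast
qed

lemma
  shows lattice_open_subgroups: "lattice (open_subgroup_lattice G T)"
    and join_open_subgroups:
      "\<And>X Y. \<lbrakk>subgroup X G; openin T X; subgroup Y G; openin T Y\<rbrakk> \<Longrightarrow>
        X \<squnion>\<^bsub>open_subgroup_lattice G T\<^esub> Y = generate G (X \<union> Y)"
    and meet_open_subgroups:
      "\<And>X Y. \<lbrakk>subgroup X G; openin T X; subgroup Y G; openin T Y\<rbrakk> \<Longrightarrow>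
        X \<sqinter>\<^bsub>open_subgroup_lattice G T\<^esub> Y = X \<inter> Y"
proof -
  let ?L = "open_subgroup_lattice G T"
  have c: "X \<in> carrier ?L \<longleftrightarrow> subgroup X G \<and> openin T X" for X
    by (simp add: open_subgroup_lattice_def)
  have l: "X \<sqsubseteq>\<^bsub>?L\<^esub> Y \<longleftrightarrow> X \<subseteq> Y" for X Y
    by (simp add: open_subgroup_lattice_def)
  have po: "partial_order ?L"
    by (unfold_locales) (auto simp: open_subgroup_lattice_def)
  have j: "least ?L (generate G (X \<union> Y)) (Upper ?L {X, Y})"
    if "X \<in> carrier ?L" "Y \<in> carrier ?L" for X Y
  proof -
    have s: "X \<union> Y \<subseteq> carrier G" using that c subgroup.subset by blast
    have X: "X \<union> Y \<subseteq> generate G (X \<union> Y)" by (auto intro: generate.incl)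
    have g: "generate G (X \<union> Y) \<in> carrier ?L"
      unfolding c using generate_is_subgroup[OF s] openin_subgroup_mono[of X] that X
      by (auto simp: c)
    show ?thesis
      using X g that generate_subgroup_incl[of "X \<union> Y"]
      unfolding least_def Upper_def by (auto simp: l c)
  qed
  have m: "greatest ?L (X \<inter> Y) (Lower ?L {X, Y})"
    if "X \<in> carrier ?L" "Y \<in> carrier ?L" for X Y
    using that subgroups_Inter_pair unfolding greatest_def Lower_def
    by (auto simp: l c openin_Int)
  note * = lattice_from_bounds[OF po j m]
  show "lattice ?L" by (rule *(1))
  show "X \<squnion>\<^bsub>?L\<^esub> Y = generate G (X \<union> Y)"
    if "subgroup X G" "openin T X" "subgroup Y G" "openin T Y" for X Y
    by (rule *(2)) (use that in \<open>simp_all add: c\<close>)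
  show "X \<sqinter>\<^bsub>?L\<^esub> Y = X \<inter> Y"
    if "subgroup X G" "openin T X" "subgroup Y G" "openin T Y" for X Y
    by (rule *(3)) (use that in \<open>simp_all add: c\<close>)
qed

end

lemma
  fixes L :: "'i \<Rightarrow> ('b, 'm) gorder_scheme"
  assumes L: "\<And>i. i \<in> I \<Longrightarrow> lattice (L i)"
  shows lattice_product_lattice: "lattice (product_lattice I L)"
    and join_product_lattice:
      "\<And>x y. \<lbrakk>x \<in> (\<Pi>\<^sub>E i\<in>I. carrier (L i)); y \<in> (\<Pi>\<^sub>E i\<in>I. carrier (L i))\<rbrakk> \<Longrightarrow>
        x \<squnion>\<^bsub>product_lattice I L\<^esub> y = (\<lambda>i\<in>I. x i \<squnion>\<^bsub>L i\<^esub> y i)"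
    and meet_product_lattice:
      "\<And>x y. \<lbrakk>x \<in> (\<Pi>\<^sub>E i\<in>I. carrier (L i)); y \<in> (\<Pi>\<^sub>E i\<in>I. carrier (L i))\<rbrakk> \<Longrightarrow>
        x \<sqinter>\<^bsub>product_lattice I L\<^esub> y = (\<lambda>i\<in>I. x i \<sqinter>\<^bsub>L i\<^esub> y i)"
proof -
  let ?P = "product_lattice I L"
  have c: "carrier ?P = (\<Pi>\<^sub>E i\<in>I. carrier (L i))"
    and e: "x .=\<^bsub>?P\<^esub> y \<longleftrightarrow> x = y"
    and l: "x \<sqsubseteq>\<^bsub>?P\<^esub> y \<longleftrightarrow> (\<forall>i\<in>I. x i \<sqsubseteq>\<^bsub>L i\<^esub> y i)" for x y
    by (simp_all add: product_lattice_def)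
  have LL: "weak_upper_semilattice (L i)" "weak_lower_semilattice (L i)" "partial_order (L i)"
    if "i \<in> I" for i
  proof -
    interpret lattice "L i" by (rule L[OF that])
    show "weak_upper_semilattice (L i)" "weak_lower_semilattice (L i)" "partial_order (L i)"
      by unfold_locales
  qed
  have wpo: "weak_partial_order (L i)" if "i \<in> I" for i
    using LL(3)[OF that] by (rule partial_order.axioms)
  have po: "partial_order ?P"
  proof (unfold_locales, unfold e)
    fix x assume "x \<in> carrier ?P"
    then show "x \<sqsubseteq>\<^bsub>?P\<^esub> x"
      by (auto simp: l c PiE_iff wpo intro: weak_partial_order.le_refl)
  next
    fix x y assume *: "x \<sqsubseteq>\<^bsub>?P\<^esub> y" "y \<sqsubseteq>\<^bsub>?P\<^esub> x" "x \<in> carrier ?P" "y \<in> carrier ?P"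
    have "x i = y i" if "i \<in> I" for i
      using partial_order.le_antisym[OF LL(3)[OF that]] * that by (auto simp: l c PiE_iff)
    then show "x = y" using * by (auto simp: c intro: PiE_ext)
  next
    fix x y z
    assume *: "x \<sqsubseteq>\<^bsub>?P\<^esub> y" "y \<sqsubseteq>\<^bsub>?P\<^esub> z" "x \<in> carrier ?P" "y \<in> carrier ?P" "z \<in> carrier ?P"
    have "x i \<sqsubseteq>\<^bsub>L i\<^esub> z i" if "i \<in> I" for i
      using weak_partial_order.le_trans[OF wpo[OF that], of "x i" "y i" "z i"] * that
      by (auto simp: l c PiE_iff)
    then show "x \<sqsubseteq>\<^bsub>?P\<^esub> z" by (simp add: l)
  qed (auto simp: e product_lattice_def)
  have j: "least ?P (\<lambda>i\<in>I. x i \<squnion>\<^bsub>L i\<^esub> y i) (Upper ?P {x, y})"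
    if "x \<in> carrier ?P" "y \<in> carrier ?P" for x y
    using that unfolding least_def Upper_def
    by (auto simp: l c PiE_iff weak_upper_semilattice.join_closed[OF LL(1)]
        weak_upper_semilattice.join_left[OF LL(1)] weak_upper_semilattice.join_right[OF LL(1)]
        intro!: weak_upper_semilattice.join_le[OF LL(1)])
  have m: "greatest ?P (\<lambda>i\<in>I. x i \<sqinter>\<^bsub>L i\<^esub> y i) (Lower ?P {x, y})"
    if "x \<in> carrier ?P" "y \<in> carrier ?P" for x y
    using that unfolding greatest_def Lower_def
    by (auto simp: l c PiE_iff weak_lower_semilattice.meet_closed[OF LL(2)]
        weak_lower_semilattice.meet_left[OF LL(2)] weak_lower_semilattice.meet_right[OF LL(2)]
        intro!: weak_lower_semilattice.meet_le[OF LL(2)])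
  note * = lattice_from_bounds[OF po j m]
  show "lattice ?P" by (rule *(1))
  show "x \<squnion>\<^bsub>?P\<^esub> y = (\<lambda>i\<in>I. x i \<squnion>\<^bsub>L i\<^esub> y i)"
    if "x \<in> (\<Pi>\<^sub>E i\<in>I. carrier (L i))" "y \<in> (\<Pi>\<^sub>E i\<in>I. carrier (L i))" for x y
    by (rule *(2)) (use that in \<open>simp_all add: c\<close>)
  show "x \<sqinter>\<^bsub>?P\<^esub> y = (\<lambda>i\<in>I. x i \<sqinter>\<^bsub>L i\<^esub> y i)"
    if "x \<in> (\<Pi>\<^sub>E i\<in>I. carrier (L i))" "y \<in> (\<Pi>\<^sub>E i\<in>I. carrier (L i))" for x y
    by (rule *(3)) (use that in \<open>simp_all add: c\<close>)
qed

end

theory Submission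
  imports Defs "HOL-Algebra.Zassenhaus" "HOL-Algebra.Multiplicative_Group"
begin

text \<open>
  Write \<open>f\<close> for the lattice isomorphism and \<open>\<tau> = f G\<close> for the greatest element of the product. For an open
  normal subgroup \<open>N\<close> let \<open>A i N\<close> be the open subgroup whose image is \<open>f N\<close> with the coordinate \<open>i\<close>
  raised to \<open>\<tau> i\<close>, and \<open>B i N\<close> the one whose image is \<open>\<tau>\<close> with the coordinate \<open>i\<close> lowered to \<open>f N i\<close>.
  Among the subgroups above \<open>N\<close> each of the two is the least supplement of the other, hence normalized by
  the other; so both are normal and \<open>G/N\<close> is the direct product of \<open>A i N/N\<close> and \<open>B i N/N\<close>. By
  compactness \<open>G\<close> is the direct product of \<open>E i\<close> and \<open>C i\<close>, the intersections of all \<open>A i N\<close> and of all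
  \<open>B i N\<close>, and therefore the product of the \<open>E i\<close>. A prime \<open>p\<close> common to \<open>E i\<close> and \<open>E j\<close> would yield,
  modulo some \<open>N\<close>, a diagonal subgroup of order \<open>p\<close> meeting \<open>A i N\<close> and \<open>B i N\<close> only in \<open>N\<close>; but in the
  product of lattices an element above \<open>f N\<close> is determined by these two meets.

  Conversely, let \<open>d\<close> lie in an open subgroup \<open>D\<close> of a product with pairwise disjoint prime sets. Every prime
  dividing the order of a coordinate of \<open>d\<close> modulo an open normal subgroup belongs to the prime set of
  that factor, so these orders are pairwise coprime and suitable powers of \<open>d\<close> isolate its coordinates.
  Hence \<open>D\<close> is the product of its intersections with the factors.
\<close>


section \<open>Profinite groups\<close>

text \<open>The topological arguments see powers lying in \<open>N\<close>, the arithmetic ones see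
  orders in the quotient; the quotient homomorphism translates between the two.\<close>

lemma (in group) pow_in_normal_iff_ord_dvd:
  assumes N: "N \<lhd> G" and x: "x \<in> carrier G"
  shows "x [^] (k::nat) \<in> N \<longleftrightarrow> group.ord (G Mod N) (N #> x) dvd k"
proof -
  interpret N: normal N G by (rule N)
  interpret Q: group "G Mod N" by (rule N.factorgroup_is_group)
  interpret h: group_hom G "G Mod N" "\<lambda>a. N #> a"
    by unfold_locales (rule N.r_coset_hom_Mod)
  have Nx: "N #> x \<in> carrier (G Mod N)" using x by (rule h.hom_closed)
  have "x [^] k \<in> N \<longleftrightarrow> N #> x [^] k = \<one>\<^bsub>G Mod N\<^esub>"
    using coset_join1[OF _ nat_pow_closed[OF x] N.subgroup_axioms]
      coset_join2[OF nat_pow_closed[OF x] N.subgroup_axioms] by (auto simp: FactGroup_def simp del: N.rcos_const)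
  also have "\<dots> \<longleftrightarrow> Q.ord (N #> x) dvd k" by (simp only: h.hom_nat_pow[OF x] Q.pow_eq_id[OF Nx])
  finally show ?thesis .
qed

section \<open>Continuity of the operations, subgroups and cosets\<close>

context topological_group
begin

lemma continuous_map_mult:
  assumes "continuous_map X T f" "continuous_map X T g"
  shows "continuous_map X T (\<lambda>x. f x \<otimes> g x)"
proof -
  have "continuous_map X (prod_topology T T) (\<lambda>x. (f x, g x))"
    using assms by (simp add: continuous_map_pairwise o_def)
  from continuous_map_compose[OF this continuous_mult] show ?thesis by (simp add: o_def)
qed

lemma continuous_map_nat_pow:
  assumes "continuous_map X T f" shows "continuous_map X T (\<lambda>x. f x [^] (n::nat))"
  by (induction n) (simp_all add: assms continuous_map_mult topspace_eq)

lemma topological_group_subgroup: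
  assumes H: "subgroup H G"
  shows "topological_group (G\<lparr>carrier := H\<rparr>) (subtopology T H)"
proof -
  have HG: "H \<subseteq> carrier G" using H subgroup.subset by blast
  interpret H: group "G\<lparr>carrier := H\<rparr>" by (rule subgroup_imp_group[OF H])
  let ?P = "prod_topology (subtopology T H) (subtopology T H)"
  have fs: "continuous_map ?P T fst" "continuous_map ?P T snd"
    using continuous_map_fst[of "subtopology T H" "subtopology T H"]
      continuous_map_snd[of "subtopology T H" "subtopology T H"]
    by (auto simp: continuous_map_in_subtopology)
  show ?thesis
  proof
    show "topspace (subtopology T H) = carrier (G\<lparr>carrier := H\<rparr>)"
      using HG by (auto simp: topspace_eq)
    show "continuous_map ?P (subtopology T H)
        (\<lambda>(x, y). x \<otimes>\<^bsub>G\<lparr>carrier := H\<rparr>\<^esub> y)"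
      using continuous_map_mult[OF fs] H
      by (auto simp: continuous_map_in_subtopology case_prod_unfold subgroup.m_closed)
    have "continuous_map (subtopology T H) (subtopology T H) (\<lambda>x. inv x)"
      using continuous_map_from_subtopology[OF continuous_inv] H
      by (auto simp: continuous_map_in_subtopology subgroup.m_inv_closed)
    then show "continuous_map (subtopology T H) (subtopology T H) (\<lambda>x. inv\<^bsub>G\<lparr>carrier := H\<rparr>\<^esub> x)"
      by (rule continuous_map_eq) (use H in \<open>simp add: m_inv_consistent\<close>)
  qed
qed

text \<open>Right translation by the inverse of \<open>x\<close> is continuous and pulls
  \<open>N\<close> back to the coset.\<close>

lemma openin_r_coset:
  assumes N: "openin T N" and x: "x \<in> carrier G"
  shows "openin T (N #> x)"
proof -
  have NG: "N \<subseteq> carrier G" using openin_subset[OF N] by (simp add: topspace_eq)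
  have "openin T {y \<in> topspace T. y \<otimes> inv x \<in> N}"
    by (rule openin_continuous_map_preimage[OF continuous_map_mult N]) (use x in \<open>simp_all add: topspace_eq\<close>)
  moreover have "{y \<in> topspace T. y \<otimes> inv x \<in> N} = N #> x"
  proof safe
    fix y assume y: "y \<in> topspace T" "y \<otimes> inv x \<in> N"
    then have "y = (y \<otimes> inv x) \<otimes> x" using x by (simp add: m_assoc topspace_eq)
    then show "y \<in> N #> x" using y by (auto simp: r_coset_def)
  next
    fix y assume "y \<in> N #> x"
    then obtain n where n: "n \<in> N" "y = n \<otimes> x" by (auto simp: r_coset_def)
    then show "y \<in> topspace T" "y \<otimes> inv x \<in> N" using x NG by (auto simp: m_assoc topspace_eq subset_iff)
  qed
  ultimately show ?thesis by simp
qed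

text \<open>The complement is a union of cosets, each of which is open.\<close>

lemma closedin_open_subgroup:
  assumes H: "subgroup H G" "openin T H"
  shows "closedin T H"
proof -
  have HG: "H \<subseteq> carrier G" using H subgroup.subset by blast
  have "carrier G - H = \<Union> ((\<lambda>x. H #> x) ` (carrier G - H))"
  proof safe
    fix x assume "x \<in> carrier G" "x \<notin> H"
    then show "x \<in> \<Union> ((\<lambda>x. H #> x) ` (carrier G - H))" using rcos_self[OF _ H(1)] by blast
  next
    fix x y assume "x \<in> carrier G" "x \<notin> H" "y \<in> H #> x"
    then show "y \<in> carrier G" using r_coset_subset_G[OF HG] by blast
  next
    fix x y assume x: "x \<in> carrier G" "x \<notin> H" and "y \<in> H #> x" and y: "y \<in> H"
    then obtain h where h: "h \<in> H" "y = h \<otimes> x" by (auto simp: r_coset_def)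
    then have "x = inv h \<otimes> y" using x HG by (auto simp: m_assoc[symmetric] subset_iff)
    moreover have "inv h \<otimes> y \<in> H" using h y H by (simp add: subgroup.m_closed subgroup.m_inv_closed)
    ultimately show False using x by simp
  qed
  moreover have "openin T (\<Union> ((\<lambda>x. H #> x) ` (carrier G - H)))"
    using openin_r_coset[OF H(2)] by blast
  ultimately show ?thesis using HG by (simp add: closedin_def topspace_eq)
qed

end

lemma totally_disconnected_space_subtopology:
  "totally_disconnected_space T \<Longrightarrow> totally_disconnected_space (subtopology T H)"
  by (auto simp: totally_disconnected_space_def connectedin_subtopology)

section \<open>Open normal subgroups and compactness\<close>

context profinite_group
begin

lemma profinite_group_closed_subgroup:
  assumes "subgroup H G" "closedin T H"
  shows "profinite_group (G\<lparr>carrier := H\<rparr>) (subtopology T H)"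
proof -
  interpret H: topological_group "G\<lparr>carrier := H\<rparr>" "subtopology T H"
    by (rule topological_group_subgroup[OF assms(1)])
  show ?thesis
    by unfold_locales
      (use assms(2) compact Hausdorff totally_disconnected in \<open>auto simp: compact_space_subtopology closedin_compact_space
        Hausdorff_space_subtopology totally_disconnected_space_subtopology\<close>)
qed

text \<open>Connected sets have at most one point here, so none of them meets both \<open>x\<close>
  and the complement of \<open>U\<close>; in a compact Hausdorff space two closed sets with that
  property are separated by a clopen set.\<close>

lemma clopen_neighbourhood:
  assumes U: "openin T U" "x \<in> U"
  obtains W where "openin T W" "closedin T W" "x \<in> W" "W \<subseteq> U"
proof -
  have xT: "x \<in> topspace T" using U openin_subset by blast
  have "separated_between T {x} (topspace T - U)"
  proof (rule cut_wire_fence_theorem[OF compact Hausdorff])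
    show "closedin T {x}"
      using Hausdorff xT by (simp add: closedin_Hausdorff_sing_eq)
    show "closedin T (topspace T - U)" using U by blast
    fix C assume "connectedin T C"
    then obtain y where "C \<subseteq> {y}" using totally_disconnected by (auto simp: totally_disconnected_space_def)
    then show "disjnt C {x} \<or> disjnt C (topspace T - U)"
      using U(2) by (auto simp: disjnt_iff)
  qed
  then obtain W V where WV: "openin T W" "openin T V" "W \<union> V = topspace T" "disjnt W V" "x \<in> W"
      "topspace T - U \<subseteq> V"
    by (auto simp: separated_between_def)
  have "W = topspace T - V" using WV by (auto simp: disjnt_iff)
  then show ?thesis using that[of W] WV by (auto simp: disjnt_iff)
qed

text \<open>The elements that act trivially on all two-sided translates of a clopen set \<open>W\<close> form a normal
  subgroup; it is open because the projection along a compact space is a closed map.\<close>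

lemma open_normal_subgroup_below:
  assumes U: "openin T U" "\<one> \<in> U"
  obtains N where "N \<lhd> G" "openin T N" "N \<subseteq> U"
proof -
  obtain W where W: "openin T W" "closedin T W" "\<one> \<in> W" "W \<subseteq> U"
    using clopen_neighbourhood[OF U] .
  define N where "N = {g \<in> carrier G. \<forall>a\<in>carrier G. \<forall>b\<in>carrier G. a \<otimes> g \<otimes> b \<in> W \<longleftrightarrow> a \<otimes> b \<in> W}"
  let ?X = "prod_topology (prod_topology T T) T"
  let ?h = "\<lambda>z. fst (fst z) \<otimes> snd z \<otimes> snd (fst z)" and ?k = "\<lambda>z. fst (fst z) \<otimes> snd (fst z)"
  have p: "continuous_map ?X T (\<lambda>z. fst (fst z))" "continuous_map ?X T (\<lambda>z. snd (fst z))"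
      "continuous_map ?X T snd"
    using continuous_map_compose[OF continuous_map_fst continuous_map_fst]
      continuous_map_compose[OF continuous_map_fst continuous_map_snd]
    by (auto simp: o_def continuous_map_snd)
  have hk: "continuous_map ?X T ?h" "continuous_map ?X T ?k"
    by (intro continuous_map_mult p)+
  have cW: "closedin T (topspace T - W)" using W by blast
  \<comment> \<open>\<open>Z\<close> collects the triples ((a, b), g) for which inserting g between
    a and b changes membership in \<open>W\<close>. It is closed because both \<open>W\<close> and
    its complement are, and \<open>N\<close> is the complement of its projection to g.\<close>
  define Z where "Z = ({z \<in> topspace ?X. ?h z \<in> W} \<inter> {z \<in> topspace ?X. ?k z \<in> topspace T - W}) \<union>
      ({z \<in> topspace ?X. ?h z \<in> topspace T - W} \<inter> {z \<in> topspace ?X. ?k z \<in> W})"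
  have "closedin ?X Z"
    unfolding Z_def
    by (intro closedin_Un closedin_Int closedin_continuous_map_preimage[OF hk(1) W(2)]
        closedin_continuous_map_preimage[OF hk(1) cW] closedin_continuous_map_preimage[OF hk(2) W(2)]
        closedin_continuous_map_preimage[OF hk(2) cW])
  moreover have "compact_space (prod_topology T T)"
    using compact by (simp add: compact_space_prod_topology)
  ultimately have "closedin T (snd ` Z)"
    using closed_map_snd[of "prod_topology T T" T] by (auto simp: closed_map_def)
  moreover have "N = topspace T - snd ` Z"
  proof -
    have "((a, b), g) \<in> Z \<longleftrightarrow> a \<in> carrier G \<and> b \<in> carrier G \<and> g \<in> carrier G \<and>
        \<not> (a \<otimes> g \<otimes> b \<in> W \<longleftrightarrow> a \<otimes> b \<in> W)" for a b g
      by (auto simp: Z_def topspace_eq)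
    then have "g \<in> snd ` Z \<longleftrightarrow> g \<in> carrier G \<and> (\<exists>a\<in>carrier G. \<exists>b\<in>carrier G.
        \<not> (a \<otimes> g \<otimes> b \<in> W \<longleftrightarrow> a \<otimes> b \<in> W))" for g
      unfolding image_iff Bex_def split_paired_Ex snd_conv by blast
    then show ?thesis unfolding N_def topspace_eq by blast
  qed
  ultimately have "openin T N" by blast
  moreover have "N \<lhd> G"
  proof (rule normal_invI)
    show "subgroup N G"
    proof (rule subgroupI)
      show "N \<noteq> {}" unfolding N_def by (rule ccontr) (use one_closed in auto)
      fix x assume x: "x \<in> N"
      then have xG: "x \<in> carrier G" by (simp add: N_def)
      { fix a b assume ab: "a \<in> carrier G" "b \<in> carrier G"
        then have "a \<otimes> inv x \<otimes> x \<otimes> b \<in> W \<longleftrightarrow> a \<otimes> inv x \<otimes> b \<in> W" using x xG by (simp add: N_def)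
        then have "a \<otimes> inv x \<otimes> b \<in> W \<longleftrightarrow> a \<otimes> b \<in> W" using xG ab by (simp add: m_assoc) }
      then show "inv x \<in> N" using xG by (simp add: N_def)
      fix y assume y: "y \<in> N"
      { fix a b assume ab: "a \<in> carrier G" "b \<in> carrier G"
        then have "a \<otimes> x \<otimes> y \<otimes> b \<in> W \<longleftrightarrow> a \<otimes> x \<otimes> b \<in> W" using xG y by (simp add: N_def)
        also have "\<dots> \<longleftrightarrow> a \<otimes> b \<in> W" using ab x by (simp add: N_def)
        finally have "a \<otimes> (x \<otimes> y) \<otimes> b \<in> W \<longleftrightarrow> a \<otimes> b \<in> W"
          using xG y ab by (simp add: m_assoc N_def) }
      then show "x \<otimes> y \<in> N" using xG y by (simp add: N_def)
    qed (auto simp: N_def)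
    fix x h assume x: "x \<in> carrier G" and h: "h \<in> N"
    then have hG: "h \<in> carrier G" by (simp add: N_def)
    { fix a b assume ab: "a \<in> carrier G" "b \<in> carrier G"
      then have "(a \<otimes> x) \<otimes> h \<otimes> (inv x \<otimes> b) \<in> W \<longleftrightarrow> (a \<otimes> x) \<otimes> (inv x \<otimes> b) \<in> W"
        using x h by (simp add: N_def)
      moreover have "(a \<otimes> x) \<otimes> (inv x \<otimes> b) = a \<otimes> b"
        using ab x by (metis inv_closed m_assoc m_closed l_one r_inv)
      ultimately have "a \<otimes> (x \<otimes> h \<otimes> inv x) \<otimes> b \<in> W \<longleftrightarrow> a \<otimes> b \<in> W"
        using x hG ab by (simp add: m_assoc) }
    then show "x \<otimes> h \<otimes> inv x \<in> N" using x hG by (simp add: N_def)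
  qed
  moreover have "N \<subseteq> W"
  proof
    fix x assume "x \<in> N"
    then have "\<one> \<otimes> x \<otimes> \<one> \<in> W \<longleftrightarrow> \<one> \<otimes> \<one> \<in> W" "x \<in> carrier G" unfolding N_def by blast+
    then show "x \<in> W" using W by simp
  qed
  ultimately show ?thesis using that W by blast
qed

lemma open_normal_subgroup_avoiding:
  assumes "x \<in> carrier G" "x \<noteq> \<one>"
  obtains N where "N \<lhd> G" "openin T N" "x \<notin> N"
proof -
  obtain U V where "openin T U" "openin T V" "\<one> \<in> U" "x \<in> V" "disjnt U V"
    using Hausdorff assms by (metis Hausdorff_space_def one_closed topspace_eq)
  then show ?thesis using open_normal_subgroup_below[of U] that by (metis disjnt_iff subsetD)
qed

lemma normal_carrier: "carrier G \<lhd> G"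
  by (simp add: normal_invI subgroup_self)

lemma openin_carrier: "openin T (carrier G)"
  using openin_topspace[of T] by (simp add: topspace_eq)

text \<open>This is the passage from solutions modulo each open normal subgroup to a solution in
  \<open>G\<close>. By monotonicity, finitely many sets \<open>C N\<close> all contain the set
  belonging to the intersection of their indices, so the finite intersection property holds.\<close>

lemma directed_closed_inter_nonempty:
  assumes C: "\<And>N. N \<lhd> G \<Longrightarrow> openin T N \<Longrightarrow> closedin T (C N) \<and> C N \<noteq> {}"
    and mono: "\<And>M N. \<lbrakk>M \<lhd> G; openin T M; N \<lhd> G; openin T N; M \<subseteq> N\<rbrakk> \<Longrightarrow> C M \<subseteq> C N"
  obtains x where "x \<in> carrier G" "\<And>N. N \<lhd> G \<Longrightarrow> openin T N \<Longrightarrow> x \<in> C N"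
proof -
  let ?N = "{N. N \<lhd> G \<and> openin T N}"
  have "\<Inter> (C ` ?N) \<noteq> {}"
  proof (rule compact[unfolded compact_space_fip, rule_format], safe)
    fix F assume F: "finite F" "F \<subseteq> C ` ?N" and e: "\<Inter> F = {}"
    obtain S where S: "S \<subseteq> ?N" "finite S" "F = C ` S" using F by (meson finite_subset_image)
    \<comment> \<open>Intersecting with the whole group takes care of the empty family, whose
      intersection is \<open>UNIV\<close>.\<close>
    have "carrier G \<inter> \<Inter> S \<in> ?N" using S(2,1)
    proof (induction S rule: finite_induct)
      case empty then show ?case by (simp add: normal_carrier openin_carrier)
    next
      case (insert N S)
      then have "N \<inter> (carrier G \<inter> \<Inter> S) \<in> ?N" using normal_subgroup_intersect by (simp add: openin_Int)
      then show ?case by (simp add: Int_left_commute)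
    qed
    then have "C (carrier G \<inter> \<Inter> S) \<noteq> {}" "C (carrier G \<inter> \<Inter> S) \<subseteq> \<Inter> F"
      using C mono S by (auto 0 3 simp: subset_iff)
    then show False using e by blast
  qed (use C in auto)
  then obtain x where x: "\<And>N. N \<lhd> G \<Longrightarrow> openin T N \<Longrightarrow> x \<in> C N" by auto
  have "x \<in> carrier G"
    using x[OF normal_carrier openin_carrier] C[OF normal_carrier openin_carrier] closedin_subset
    by (metis subsetD topspace_eq)
  then show ?thesis using that x by blast
qed

text \<open>The cosets form an open cover by nonempty, pairwise disjoint sets, so a finite subcover
  must contain all of them.\<close>

lemma finite_rcosets_open:
  assumes N: "subgroup N G" "openin T N"
  shows "finite (rcosets N)"
proof -
  have "\<exists>\<F>. finite \<F> \<and> \<F> \<subseteq> rcosets N \<and> topspace T \<subseteq> \<Union> \<F>"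
    by (rule compact[unfolded compact_space_alt, rule_format])
      (use openin_r_coset[OF N(2)] rcosets_part_G[OF N(1)] in \<open>auto simp: RCOSETS_def topspace_eq\<close>)
  then obtain F where F: "finite F" "F \<subseteq> rcosets N" "carrier G \<subseteq> \<Union> F"
    by (auto simp: topspace_eq)
  have "rcosets N \<subseteq> F"
  proof
    fix c assume c: "c \<in> rcosets N"
    then obtain x where x: "x \<in> c" "x \<in> carrier G"
      using N(1) by (auto simp: RCOSETS_def intro: rcos_self[OF _ N(1)])
    then obtain d where "d \<in> F" "x \<in> d" using F by blast
    then have "d = c" using rcos_disjoint[OF N(1)] F(2) c x by (auto simp: pairwise_def disjnt_iff)
    then show "c \<in> F" using \<open>d \<in> F\<close> by simp
  qed
  then show ?thesis using F finite_subset by blast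
qed

text \<open>The bound is uniform in \<open>x\<close>. It later replaces "some power of p" by one
  fixed exponent, which makes a torsion condition closed.\<close>

lemma ord_modulo_open:
  assumes N: "N \<lhd> G" "openin T N" and x: "x \<in> carrier G"
  shows "group.ord (G Mod N) (N #> x) > 0"
    and "group.ord (G Mod N) (N #> x) \<le> card (rcosets N)"
proof -
  interpret N: normal N G by (rule N)
  interpret Q: group "G Mod N" by (rule N.factorgroup_is_group)
  have Nx: "N #> x \<in> carrier (G Mod N)" using x by (auto simp: FactGroup_def RCOSETS_def)
  have f: "finite (carrier (G Mod N))"
    using finite_rcosets_open[OF N.subgroup_axioms N(2)] by (simp add: FactGroup_def)
  then show "Q.ord (N #> x) > 0" using Q.ord_ge_1[OF _ Nx] by simp
  show "Q.ord (N #> x) \<le> card (rcosets N)"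
    using Q.ord_le_group_order[OF f Nx] by (simp add: order_def FactGroup_def)
qed

end

section \<open>Order isomorphisms and procyclic pro-\<open>p\<close> subgroups\<close>

text \<open>Order isomorphisms compose and invert without reference to joins and meets, so all later
  work is done with them; \<open>lattice_iso_iff_order_iso\<close> returns to
  \<open>lattice_iso\<close>.\<close>

definition order_iso :: "('a, 'm) gorder_scheme \<Rightarrow> ('b, 'n) gorder_scheme \<Rightarrow> bool" where
  "order_iso L M \<longleftrightarrow> (\<exists>f. bij_betw f (carrier L) (carrier M) \<and>
     (\<forall>x\<in>carrier L. \<forall>y\<in>carrier L. f x \<sqsubseteq>\<^bsub>M\<^esub> f y \<longleftrightarrow> x \<sqsubseteq>\<^bsub>L\<^esub> y))"

lemma order_iso_trans:
  assumes "order_iso L M" "order_iso M N" shows "order_iso L N"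
proof -
  obtain f g where f: "bij_betw f (carrier L) (carrier M)"
      "\<And>x y. \<lbrakk>x \<in> carrier L; y \<in> carrier L\<rbrakk> \<Longrightarrow> f x \<sqsubseteq>\<^bsub>M\<^esub> f y \<longleftrightarrow> x \<sqsubseteq>\<^bsub>L\<^esub> y"
    and g: "bij_betw g (carrier M) (carrier N)"
      "\<And>x y. \<lbrakk>x \<in> carrier M; y \<in> carrier M\<rbrakk> \<Longrightarrow> g x \<sqsubseteq>\<^bsub>N\<^esub> g y \<longleftrightarrow> x \<sqsubseteq>\<^bsub>M\<^esub> y"
    using assms unfolding order_iso_def by metis
  have "bij_betw (g \<circ> f) (carrier L) (carrier N)" by (rule bij_betw_trans[OF f(1) g(1)])
  moreover have "f x \<in> carrier M" if "x \<in> carrier L" for x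
    using f(1) that by (auto simp: bij_betw_def)
  ultimately show ?thesis unfolding order_iso_def by (intro exI[of _ "g \<circ> f"]) (simp add: f g)
qed

lemma order_iso_sym:
  assumes "order_iso L M" shows "order_iso M L"
proof -
  obtain f where f: "bij_betw f (carrier L) (carrier M)"
      "\<And>x y. \<lbrakk>x \<in> carrier L; y \<in> carrier L\<rbrakk> \<Longrightarrow> f x \<sqsubseteq>\<^bsub>M\<^esub> f y \<longleftrightarrow> x \<sqsubseteq>\<^bsub>L\<^esub> y"
    using assms unfolding order_iso_def by metis
  let ?g = "inv_into (carrier L) f"
  have g: "bij_betw ?g (carrier M) (carrier L)" by (rule bij_betw_inv_into[OF f(1)])
  have "?g x \<in> carrier L \<and> f (?g x) = x" if "x \<in> carrier M" for x
    using f(1) that g by (auto simp: bij_betw_inv_into_right bij_betw_def)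
  then show ?thesis unfolding order_iso_def using g by (intro exI[of _ ?g]) (metis f(2))
qed

text \<open>Meets determine the order, since x lies below y exactly when it equals its meet with y.
  Conversely an order isomorphism carries bounds to bounds, and by surjectivity the join or meet
  formed in \<open>M\<close> comes from a bound in \<open>L\<close>, which gives the second
  inequality.\<close>

lemma lattice_iso_iff_order_iso:
  assumes L: "lattice L" and M: "lattice M"
  shows "lattice_iso L M \<longleftrightarrow> order_iso L M"
proof
  interpret L: lattice L by (rule L)
  interpret M: lattice M by (rule M)
  {
    assume "lattice_iso L M"
    then obtain f where f: "bij_betw f (carrier L) (carrier M)" "meet_pres L M f"
      unfolding lattice_iso_def by blast
    have fc: "f x \<in> carrier M" if "x \<in> carrier L" for x
      using f(1) that by (auto simp: bij_betw_def)
    have "f x \<sqsubseteq>\<^bsub>M\<^esub> f y \<longleftrightarrow> x \<sqsubseteq>\<^bsub>L\<^esub> y" if xy: "x \<in> carrier L" "y \<in> carrier L" for x y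
    proof -
      have "f x \<sqsubseteq>\<^bsub>M\<^esub> f y \<longleftrightarrow> f x = f (x \<sqinter>\<^bsub>L\<^esub> y)"
        using f(2) xy fc by (simp add: M.le_iff_join meet_pres_def)
      also have "\<dots> \<longleftrightarrow> x = x \<sqinter>\<^bsub>L\<^esub> y"
        using f(1) xy by (auto simp: bij_betw_def inj_on_eq_iff)
      finally show ?thesis using xy by (simp add: L.le_iff_join)
    qed
    then show "order_iso L M" unfolding order_iso_def using f(1) by blast
  }
  {
    assume "order_iso L M"
    then obtain f where f: "bij_betw f (carrier L) (carrier M)"
        "\<And>x y. \<lbrakk>x \<in> carrier L; y \<in> carrier L\<rbrakk> \<Longrightarrow> f x \<sqsubseteq>\<^bsub>M\<^esub> f y \<longleftrightarrow> x \<sqsubseteq>\<^bsub>L\<^esub> y"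
      unfolding order_iso_def by metis
    have fc: "f x \<in> carrier M" if "x \<in> carrier L" for x
      using f(1) that by (auto simp: bij_betw_def)
    have fs: "\<exists>z\<in>carrier L. f z = u" if "u \<in> carrier M" for u
      using f(1) that unfolding bij_betw_def by (metis imageE)
    have "f (x \<squnion>\<^bsub>L\<^esub> y) = f x \<squnion>\<^bsub>M\<^esub> f y" if xy: "x \<in> carrier L" "y \<in> carrier L" for x y
    proof -
      have c: "f x \<in> carrier M" "f y \<in> carrier M" "x \<squnion>\<^bsub>L\<^esub> y \<in> carrier L" using xy fc by auto
      obtain z where z: "z \<in> carrier L" "f z = f x \<squnion>\<^bsub>M\<^esub> f y" using fs[OF M.join_closed[OF c(1,2)]] by blast
      have "x \<sqsubseteq>\<^bsub>L\<^esub> z" "y \<sqsubseteq>\<^bsub>L\<^esub> z" using f(2)[OF _ z(1)] xy c z(2) by (metis M.join_left M.join_right)+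
      then have "f (x \<squnion>\<^bsub>L\<^esub> y) \<sqsubseteq>\<^bsub>M\<^esub> f x \<squnion>\<^bsub>M\<^esub> f y"
        using f(2)[OF c(3) z(1)] z xy by (simp add: L.join_le)
      moreover have "f x \<squnion>\<^bsub>M\<^esub> f y \<sqsubseteq>\<^bsub>M\<^esub> f (x \<squnion>\<^bsub>L\<^esub> y)"
        using xy c fc by (intro M.join_le) (simp_all add: f(2) L.join_left L.join_right)
      ultimately show ?thesis using c fc by (simp add: M.le_antisym)
    qed
    moreover have "f (x \<sqinter>\<^bsub>L\<^esub> y) = f x \<sqinter>\<^bsub>M\<^esub> f y" if xy: "x \<in> carrier L" "y \<in> carrier L" for x y
    proof -
      have c: "f x \<in> carrier M" "f y \<in> carrier M" "x \<sqinter>\<^bsub>L\<^esub> y \<in> carrier L" using xy fc by auto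
      obtain z where z: "z \<in> carrier L" "f z = f x \<sqinter>\<^bsub>M\<^esub> f y" using fs[OF M.meet_closed[OF c(1,2)]] by blast
      have "z \<sqsubseteq>\<^bsub>L\<^esub> x" "z \<sqsubseteq>\<^bsub>L\<^esub> y" using f(2)[OF z(1)] xy c z(2) by (metis M.meet_left M.meet_right)+
      then have "f x \<sqinter>\<^bsub>M\<^esub> f y \<sqsubseteq>\<^bsub>M\<^esub> f (x \<sqinter>\<^bsub>L\<^esub> y)"
        using f(2)[OF z(1) c(3)] z xy by (simp add: L.meet_le)
      moreover have "f (x \<sqinter>\<^bsub>L\<^esub> y) \<sqsubseteq>\<^bsub>M\<^esub> f x \<sqinter>\<^bsub>M\<^esub> f y"
        using xy c fc by (intro M.meet_le) (simp_all add: f(2) L.meet_left L.meet_right)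
      ultimately show ?thesis using c fc by (simp add: M.le_antisym)
    qed
    ultimately show "lattice_iso L M"
      unfolding lattice_iso_def join_pres_def meet_pres_def using f(1) L M by blast
  }
qed

lemma order_iso_product_lattice:
  assumes "\<And>i. i \<in> I \<Longrightarrow> order_iso (L i) (M i)"
  shows "order_iso (product_lattice I L) (product_lattice I M)"
proof -
  obtain f where f: "\<And>i. i \<in> I \<Longrightarrow> bij_betw (f i) (carrier (L i)) (carrier (M i))"
      "\<And>i x y. \<lbrakk>i \<in> I; x \<in> carrier (L i); y \<in> carrier (L i)\<rbrakk> \<Longrightarrow> f i x \<sqsubseteq>\<^bsub>M i\<^esub> f i y \<longleftrightarrow> x \<sqsubseteq>\<^bsub>L i\<^esub> y"
    using assms unfolding order_iso_def by metis
  let ?F = "\<lambda>x. \<lambda>i\<in>I. f i (x i)" and ?G = "\<lambda>y. \<lambda>i\<in>I. inv_into (carrier (L i)) (f i) (y i)"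
  have m: "f i u \<in> carrier (M i)" "inv_into (carrier (L i)) (f i) (f i u) = u" if "i \<in> I" "u \<in> carrier (L i)" for i u
    using f(1)[OF that(1)] that(2) by (auto simp: bij_betw_def)
  have n: "inv_into (carrier (L i)) (f i) u \<in> carrier (L i)" "f i (inv_into (carrier (L i)) (f i) u) = u"
    if "i \<in> I" "u \<in> carrier (M i)" for i u
    using f(1)[OF that(1)] that(2) by (auto simp: bij_betw_def inv_into_into f_inv_into_f)
  have "bij_betw ?F (\<Pi>\<^sub>E i\<in>I. carrier (L i)) (\<Pi>\<^sub>E i\<in>I. carrier (M i))"
    by (rule bij_betw_byWitness[where f' = ?G])
      (auto simp: PiE_iff m n extensional_def fun_eq_iff)
  then show ?thesis unfolding order_iso_def
    by (intro exI[of _ ?F]) (auto simp: product_lattice_def PiE_iff f(2))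
qed

lemma subgroup_iso_image:
  assumes f: "f \<in> iso G H" and G: "group G" "group H" and X: "X \<subseteq> carrier G"
  shows "subgroup (f ` X) H \<longleftrightarrow> subgroup X G"
proof
  assume fX: "subgroup (f ` X) H"
  let ?g = "inv_into (carrier G) f"
  have g: "?g \<in> iso H G" using group.iso_set_sym[OF G(1) f] .
  have "subgroup (?g ` (f ` X)) G"
    using group_hom.subgroup_img_is_subgroup[OF _ fX] g G
    by (auto simp: iso_def group_hom_def group_hom_axioms_def)
  moreover have "?g ` (f ` X) = X"
    using f X by (auto simp: iso_def bij_betw_def inv_into_image_cancel)
  ultimately show "subgroup X G" by simp
next
  assume X: "subgroup X G"
  show "subgroup (f ` X) H"
    using group_hom.subgroup_img_is_subgroup[OF _ X] f G
    by (auto simp: iso_def group_hom_def group_hom_axioms_def)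
qed

lemma order_iso_open_subgroups:
  assumes GH: "topological_group_iso G T H U" and G: "group G" "group H"
    and T: "topspace T = carrier G" "topspace U = carrier H"
  shows "order_iso (open_subgroup_lattice G T) (open_subgroup_lattice H U)"
proof -
  obtain f where f: "f \<in> iso G H" "homeomorphic_map T U f"
    using GH unfolding topological_group_iso_def by blast
  have inj: "inj_on f (carrier G)" and im: "f ` carrier G = carrier H"
    using f(1) by (auto simp: iso_def bij_betw_def)
  have eq: "subgroup (f ` X) H \<and> openin U (f ` X) \<longleftrightarrow> subgroup X G \<and> openin T X" if "X \<subseteq> carrier G" for X
    using subgroup_iso_image[OF f(1) G that] homeomorphic_map_openness[OF f(2)] that T by simp
  have sG: "X \<subseteq> carrier G" if "subgroup X G" for X using that subgroup.subset by blast
  have sH: "D \<subseteq> carrier H" if "subgroup D H" for D using that subgroup.subset by blast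
  have "bij_betw (image f) {X. subgroup X G \<and> openin T X} {D. subgroup D H \<and> openin U D}"
    unfolding bij_betw_def
  proof
    show "inj_on (image f) {X. subgroup X G \<and> openin T X}"
      by (rule inj_on_image[OF inj_on_subset[OF inj]]) (use sG in blast)
    show "image f ` {X. subgroup X G \<and> openin T X} = {D. subgroup D H \<and> openin U D}"
    proof safe
      fix D assume D: "subgroup D H" "openin U D"
      obtain X where X: "X \<subseteq> carrier G" "D = f ` X"
        using sH[OF D(1)] im by (metis subset_imageE)
      then show "D \<in> image f ` {X. subgroup X G \<and> openin T X}" using D eq by blast
    qed (use eq sG in blast)+
  qed
  moreover have "f ` X \<subseteq> f ` Y \<longleftrightarrow> X \<subseteq> Y" if "subgroup X G" "subgroup Y G" for X Y
    using inj_on_image_subset_iff[OF inj] sG that by blast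
  ultimately show ?thesis
    unfolding order_iso_def open_subgroup_lattice_def by (intro exI[of _ "image f"]) auto
qed

context topological_group
begin

text \<open>A continuous map sends the closure of a set into the closure of its image; for
  multiplication one also uses that the closure of \<open>H \<times> H\<close> is the product of the
  closures.\<close>

lemma subgroup_closure:
  assumes H: "subgroup H G"
  shows "subgroup (T closure_of H) G"
proof (rule subgroupI)
  have HG: "H \<subseteq> carrier G" using H subgroup.subset by blast
  show "T closure_of H \<subseteq> carrier G" using closure_of_subset_topspace[of T H] by (simp add: topspace_eq)
  show "T closure_of H \<noteq> {}"
    using closure_of_subset[of H T] HG subgroup.one_closed[OF H] by (auto simp: topspace_eq)
  fix x assume x: "x \<in> T closure_of H"
  have "(\<lambda>x. inv x) ` (T closure_of H) \<subseteq> T closure_of ((\<lambda>x. inv x) ` H)"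
    by (rule continuous_map_image_closure_subset[OF continuous_inv])
  also have "\<dots> \<subseteq> T closure_of H"
    by (rule closure_of_mono) (use H in \<open>auto simp: subgroup.m_inv_closed\<close>)
  finally show "inv x \<in> T closure_of H" using x by blast
  fix y assume y: "y \<in> T closure_of H"
  have "(\<lambda>(x, y). x \<otimes> y) ` (prod_topology T T closure_of (H \<times> H)) \<subseteq>
      T closure_of ((\<lambda>(x, y). x \<otimes> y) ` (H \<times> H))"
    by (rule continuous_map_image_closure_subset[OF continuous_mult])
  also have "\<dots> \<subseteq> T closure_of H"
    by (rule closure_of_mono) (use H in \<open>auto simp: subgroup.m_closed\<close>)
  finally show "x \<otimes> y \<in> T closure_of H" using x y by (auto simp: closure_of_Times)
qed

end

section \<open>Procyclic pro-p subgroups and primes dividing orders modulo open normal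
  subgroups\<close>

context profinite_group
begin

text \<open>The witness is the closure of the cyclic group generated by \<open>y\<close>. It is
  pro-p because, modulo an open normal subgroup, the image of \<open>y\<close> has p-power order and
  generates the whole quotient by density.\<close>

lemma closed_subgroup_in_pi_star:
  assumes y: "y \<in> carrier G" "y \<noteq> \<one>" and p: "prime p"
    and pow: "\<And>M. M \<lhd> G \<Longrightarrow> openin T M \<Longrightarrow> \<exists>k. y [^] (p ^ k) \<in> M"
  shows "p \<in> pi_star G T"
proof -
  let ?A = "generate G {y}"
  define S where "S = T closure_of ?A"
  have A: "subgroup ?A G" using y by (simp add: generate_is_subgroup)
  have AS: "?A \<subseteq> S"
    unfolding S_def using subgroup.subset[OF A] by (intro closure_of_subset) (simp add: topspace_eq)
  have yS: "y \<in> S" using AS generate.incl[of y "{y}"] by blast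
  have S: "subgroup S G" "closedin T S"
    unfolding S_def using subgroup_closure[OF A] by auto
  let ?S = "G\<lparr>carrier := S\<rparr>" and ?T = "subtopology T S"
  interpret S: profinite_group ?S ?T by (rule profinite_group_closed_subgroup[OF S])
  have gen: "generate ?S {y} = ?A" using yS by (intro generate_consistent[OF _ S(1)]) simp
  have dense: "?T closure_of ?A = S"
    using AS by (simp add: closure_of_subtopology Int_absorb1 S_def[symmetric])
  have "procyclic_group ?S ?T"
    by unfold_locales (use yS gen dense in \<open>auto intro!: bexI[of _ y]\<close>)
  moreover have "pro_p_group ?S ?T p"
  proof (unfold_locales)
    fix K assume K: "K \<lhd> ?S" "openin ?T K"
    interpret K: normal K ?S by (rule K(1))
    interpret Q: group "?S Mod K" by (rule K.factorgroup_is_group)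
    interpret h: group_hom ?S "?S Mod K" "\<lambda>a. K #>\<^bsub>?S\<^esub> a"
      by unfold_locales (rule K.r_coset_hom_Mod)
    let ?y = "K #>\<^bsub>?S\<^esub> y"
    have yc: "?y \<in> carrier (?S Mod K)" using yS by (intro h.hom_closed) simp
    \<comment> \<open>The hypothesis \<open>pow\<close> speaks of open normal subgroups of
      \<open>G\<close>, whereas \<open>K\<close> is only open and normal in the closure
      \<open>S\<close>; so an \<open>M\<close> with \<open>M \<inter> S\<close> inside
      \<open>K\<close> is needed.\<close>
    obtain V where V: "openin T V" "K = V \<inter> S" using K(2) by (auto simp: openin_subtopology)
    then have "\<one> \<in> V" using K.one_closed by simp
    then obtain M where M: "M \<lhd> G" "openin T M" "M \<subseteq> V" using open_normal_subgroup_below[OF V(1)] by blast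
    obtain k where k: "y [^] (p ^ k) \<in> M" using pow M by blast
    moreover have "y [^] (p ^ k) \<in> S" using yS S.nat_pow_closed[of y "p ^ k"] by (simp add: nat_pow_consistent[symmetric])
    ultimately have "y [^]\<^bsub>?S\<^esub> (p ^ k) \<in> K" using V M(3) by (auto simp: nat_pow_consistent[symmetric])
    then have "Q.ord ?y dvd p ^ k" using S.pow_in_normal_iff_ord_dvd[OF K(1)] yS by simp
    then obtain j where j: "Q.ord ?y = p ^ j" using divides_primepow_nat[OF p] by blast
    have "rcosets\<^bsub>?S\<^esub> K \<subseteq> generate (?S Mod K) {?y}"
    proof
      fix c assume "c \<in> rcosets\<^bsub>?S\<^esub> K"
      then obtain z where z: "z \<in> S" "c = K #>\<^bsub>?S\<^esub> z" by (auto simp: RCOSETS_def)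
      \<comment> \<open>An open coset meets the dense cyclic subgroup, hence it is represented by a
        power of \<open>y\<close>.\<close>
      have "openin ?T c" using S.openin_r_coset[OF K(2)] z by simp
      moreover have "z \<in> c" using S.rcos_self[OF _ K.subgroup_axioms] z by simp
      moreover have "z \<in> ?T closure_of ?A" using dense z by simp
      ultimately obtain g where g: "g \<in> ?A" "g \<in> c" by (meson in_closure_of)
      then have gS: "g \<in> S" using AS by blast
      have "c = K #>\<^bsub>?S\<^esub> g"
        using S.repr_independence[OF _ _ K.subgroup_axioms, of g z] g z by simp
      moreover obtain i :: int where "g = y [^]\<^bsub>?S\<^esub> i"
        using g(1) yS S.generate_pow[of y] unfolding gen by auto
      ultimately have "c = ?y [^]\<^bsub>?S Mod K\<^esub> i" using yS h.hom_int_pow[of y i] by simp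
      then show "c \<in> generate (?S Mod K) {?y}" using Q.generate_pow[OF yc] by blast
    qed
    moreover have "generate (?S Mod K) {?y} \<subseteq> rcosets\<^bsub>?S\<^esub> K"
      using Q.generate_incl[of "{?y}"] yc by (simp add: FactGroup_def)
    ultimately have "card (rcosets\<^bsub>?S\<^esub> K) = Q.ord ?y" using Q.generate_pow_card[OF yc] by simp
    then show "\<exists>k. card (rcosets\<^bsub>?S\<^esub> K) = p ^ k" using j by auto
  qed
  moreover have "S \<noteq> {\<one>}" using yS y by blast
  ultimately show ?thesis unfolding pi_star_def using S p by blast
qed

text \<open>The aim is an element \<open>y\<close> outside \<open>N\<close> that has p-power order
  modulo every open normal subgroup. Modulo a single \<open>M\<close> a power of \<open>x\<close>
  does this; the sets \<open>C M\<close> of all such candidates are closed and decrease with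
  \<open>M\<close>, so compactness yields a common one.\<close>

lemma prime_dvd_order_in_pi_star:
  assumes N: "N \<lhd> G" "openin T N" and x: "x \<in> carrier G"
    and p: "prime p" "p dvd group.ord (G Mod N) (N #> x)"
  shows "p \<in> pi_star G T"
proof -
  have one: "\<one> \<in> N" using N(1) by (simp add: normal_imp_subgroup subgroup.one_closed)
  define C where "C M = {y \<in> carrier G. (\<exists>k. y [^] (p ^ k) \<in> M)} - N" for M
  obtain y where y: "y \<in> carrier G" "\<And>M. M \<lhd> G \<Longrightarrow> openin T M \<Longrightarrow> y \<in> C M"
  proof (rule directed_closed_inter_nonempty[of C])
    fix M assume M: "M \<lhd> G" "openin T M"
    \<comment> \<open>If the order modulo \<open>M\<close> is \<open>p ^ a\<close>, then a is less
      than \<open>p ^ a\<close> and hence below the index. So this one exponent serves every element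
      and the torsion set is a preimage under a single power map.\<close>
    let ?n = "card (rcosets M)"
    have "{y \<in> carrier G. \<exists>k. y [^] (p ^ k) \<in> M} = {y \<in> topspace T. y [^] (p ^ ?n) \<in> M}"
      unfolding topspace_eq
    proof (intro Collect_cong conj_cong refl iffI; (elim exE)?)
      fix y k assume y: "y \<in> carrier G" "y [^] (p ^ k) \<in> M"
      then obtain a where a: "group.ord (G Mod M) (M #> y) = p ^ a"
        using pow_in_normal_iff_ord_dvd[OF M(1)] divides_primepow_nat[OF p(1)] by blast
      have "a < p ^ a" using prime_gt_1_nat[OF p(1)] by (simp add: power_gt_expt)
      then have "a \<le> ?n" using ord_modulo_open(2)[OF M y(1)] a by simp
      then show "y [^] (p ^ ?n) \<in> M"
        using y(1) a by (simp add: pow_in_normal_iff_ord_dvd[OF M(1)] le_imp_power_dvd)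
    qed blast
    moreover have "closedin T {y \<in> topspace T. y [^] (p ^ ?n) \<in> M}"
      by (intro closedin_continuous_map_preimage[OF continuous_map_nat_pow] continuous_map_id[unfolded id_def]
          closedin_open_subgroup normal_imp_subgroup M)
    ultimately have "closedin T (C M)" unfolding C_def using N(2) by (simp add: closedin_diff)
    moreover have "C M \<noteq> {}"
    proof -
      \<comment> \<open>Remove the full power of p from the order of \<open>x\<close> modulo
        \<open>M \<inter> N\<close>, leaving r'. The power of \<open>x\<close> with exponent r' has
        p-power order modulo \<open>M\<close>, and it stays outside \<open>N\<close> since p divides
        the order of \<open>x\<close> modulo \<open>N\<close> but not r'.\<close>
      have MN: "M \<inter> N \<lhd> G" "openin T (M \<inter> N)" using M N by (auto simp: normal_subgroup_intersect)
      let ?r = "group.ord (G Mod (M \<inter> N)) ((M \<inter> N) #> x)"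
      have "?r \<noteq> 0" "\<not> is_unit p" using ord_modulo_open(1)[OF MN x] p by auto
      then obtain r' where r': "?r = p ^ multiplicity p ?r * r'" "\<not> p dvd r'"
        by (rule multiplicity_decompose')
      have "(x [^] r') [^] (p ^ multiplicity p ?r) = x [^] ?r"
        using x r'(1) by (simp add: nat_pow_pow mult.commute)
      moreover have "x [^] ?r \<in> M \<inter> N" by (rule pow_in_normal_iff_ord_dvd[OF MN(1) x, THEN iffD2, OF dvd_refl])
      moreover have "x [^] r' \<notin> N"
        using pow_in_normal_iff_ord_dvd[OF N(1) x] p(2) r'(2) dvd_trans by blast
      ultimately have "x [^] r' \<in> C M"
        unfolding C_def using x by (auto intro!: exI[of _ "multiplicity p ?r"])
      then show ?thesis by blast
    qed
    ultimately show "closedin T (C M) \<and> C M \<noteq> {}" by simp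
  qed (auto simp: C_def)
  have "y \<notin> N" using y(2)[OF N] by (simp add: C_def)
  then show ?thesis
    using closed_subgroup_in_pi_star[OF y(1) _ p(1)] y(2) one unfolding C_def by blast
qed

end

section \<open>Open subgroups of a product\<close>

definition single_coordinate ::
    "'i set \<Rightarrow> ('i \<Rightarrow> ('a, 'm) monoid_scheme) \<Rightarrow> 'i \<Rightarrow> 'a \<Rightarrow> 'i \<Rightarrow> 'a" where
  "single_coordinate I H i x = (\<lambda>j\<in>I. if j = i then x else \<one>\<^bsub>H j\<^esub>)"

text \<open>A preimage under the embedding of the factor, not an image under the projection: it
  represents the intersection of \<open>D\<close> with the factor, as a subset of
  \<open>H i\<close>.\<close>

definition coordinate_part ::
    "'i set \<Rightarrow> ('i \<Rightarrow> ('a, 'm) monoid_scheme) \<Rightarrow> ('i \<Rightarrow> 'a) set \<Rightarrow> 'i \<Rightarrow> 'a set" where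
  "coordinate_part I H D i = {x \<in> carrier (H i). single_coordinate I H i x \<in> D}"

locale profinite_family =
  fixes I :: "'i set" and H :: "'i \<Rightarrow> ('a, 'm) monoid_scheme" and U :: "'i \<Rightarrow> 'a topology"
  assumes finite_index: "finite I"
    and profinite: "\<And>i. i \<in> I \<Longrightarrow> profinite_group (H i) (U i)"
begin

abbreviation "P \<equiv> product_group I H"
abbreviation "TP \<equiv> product_topology U I"
abbreviation "single \<equiv> single_coordinate I H"
abbreviation "fac \<equiv> coordinate_part I H"

lemma group_factor: "i \<in> I \<Longrightarrow> group (H i)"
  using profinite by (simp add: profinite_group_def topological_group_def)

lemma topspace_factor: "i \<in> I \<Longrightarrow> topspace (U i) = carrier (H i)"
  by (rule topological_group.topspace_eq[OF profinite_group.axioms(1)[OF profinite]])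

lemma one_factor: "i \<in> I \<Longrightarrow> \<one>\<^bsub>H i\<^esub> \<in> carrier (H i)"
  by (simp add: group_factor group.is_monoid)

lemma group_P: "group P"
  by (simp add: group_factor)

lemma single_hom:
  assumes i: "i \<in> I" shows "single i \<in> hom (H i) P"
proof (rule homI)
  show "single i x \<in> carrier P" if "x \<in> carrier (H i)" for x
    using that one_factor by (auto simp: single_coordinate_def)
  have "\<one>\<^bsub>H j\<^esub> = \<one>\<^bsub>H j\<^esub> \<otimes>\<^bsub>H j\<^esub> \<one>\<^bsub>H j\<^esub>" if "j \<in> I" for j
    using group_factor[OF that] by (simp add: group.is_monoid)
  then show "single i (x \<otimes>\<^bsub>H i\<^esub> y) = single i x \<otimes>\<^bsub>P\<^esub> single i y" for x y
    unfolding single_coordinate_def mult_product_group by (intro restrict_ext) simp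
qed

lemma continuous_single:
  assumes i: "i \<in> I" shows "continuous_map (U i) TP (single i)"
proof -
  have "continuous_map (U i) (U k) (\<lambda>x. single i x k)" if k: "k \<in> I" for k
    using k i by (cases "k = i") (simp_all add: single_coordinate_def topspace_factor one_factor)
  then show ?thesis by (auto simp: continuous_map_componentwise single_coordinate_def)
qed

lemma part_open_subgroup:
  assumes D: "subgroup D P" "openin TP D" and i: "i \<in> I"
  shows "subgroup (fac D i) (H i)" "openin (U i) (fac D i)"
proof -
  interpret Hi: group "H i" using group_factor[OF i] .
  interpret s: group_hom "H i" P "single i"
    by (intro group_hom.intro group_hom_axioms.intro Hi.group_axioms group_P single_hom i)
  show "subgroup (fac D i) (H i)"
  proof (rule Hi.subgroupI)
    have "single i \<one>\<^bsub>H i\<^esub> \<in> D" using subgroup.one_closed[OF D(1)] by (simp only: s.hom_one)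
    then show "fac D i \<noteq> {}" unfolding coordinate_part_def using Hi.one_closed by blast
    fix x assume x: "x \<in> fac D i"
    then show "inv\<^bsub>H i\<^esub> x \<in> fac D i"
      using subgroup.m_inv_closed[OF D(1), of "single i x"] s.hom_inv[of x]
      by (simp add: coordinate_part_def del: inv_product_group)
    fix y assume "y \<in> fac D i"
    then show "x \<otimes>\<^bsub>H i\<^esub> y \<in> fac D i"
      using x subgroup.m_closed[OF D(1)] s.hom_mult[of x y] unfolding coordinate_part_def by auto
  qed (auto simp: coordinate_part_def)
  show "openin (U i) (fac D i)"
    using openin_continuous_map_preimage[OF continuous_single[OF i] D(2)]
    by (simp add: coordinate_part_def topspace_factor[OF i])
qed

text \<open>As \<open>I\<close> is finite, \<open>x\<close> is a finite product of its
  single-coordinate elements; the induction fills in one coordinate at a time, with the identity in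
  the remaining ones.\<close>

lemma mem_subgroup_if_singles:
  assumes D: "subgroup D P" and x: "x \<in> carrier P" and s: "\<And>i. i \<in> I \<Longrightarrow> single i (x i) \<in> D"
  shows "x \<in> D"
proof -
  have "(\<lambda>j\<in>I. if j \<in> J then x j else \<one>\<^bsub>H j\<^esub>) \<in> D" if "finite J" "J \<subseteq> I" for J
    using that
  proof (induction J rule: finite_induct)
    case empty then show ?case using subgroup.one_closed[OF D] by (simp add: restrict_def)
  next
    case (insert i J)
    then have "single i (x i) \<otimes>\<^bsub>P\<^esub> (\<lambda>j\<in>I. if j \<in> J then x j else \<one>\<^bsub>H j\<^esub>) \<in> D"
      using subgroup.m_closed[OF D] s by blast
    moreover have "single i (x i) \<otimes>\<^bsub>P\<^esub> (\<lambda>j\<in>I. if j \<in> J then x j else \<one>\<^bsub>H j\<^esub>) =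
        (\<lambda>j\<in>I. if j \<in> insert i J then x j else \<one>\<^bsub>H j\<^esub>)"
      using x insert.hyps group_factor one_factor
      by (auto simp: single_coordinate_def fun_eq_iff group.is_monoid PiE_iff)
    ultimately show ?case by (simp only:)
  qed
  from this[OF finite_index] have "(\<lambda>j\<in>I. x j) \<in> D" by (simp cong: restrict_cong)
  moreover have "(\<lambda>j\<in>I. x j) = x" using x by (auto simp: PiE_iff extensional_def fun_eq_iff)
  ultimately show ?thesis by simp
qed

lemma nat_pow_product:
  assumes "j \<in> I" shows "(d [^]\<^bsub>P\<^esub> (n::nat)) j = d j [^]\<^bsub>H j\<^esub> n"
  using assms by (induction n) (simp_all)

text \<open>The orders of the coordinates of \<open>d\<close> modulo suitable open normal subgroups are pairwise coprime,
  so that by the Chinese remainder theorem some power of \<open>d\<close> approximates its \<open>i\<close>-th coordinate.\<close>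

lemma single_mem_open_subgroup:
  assumes disj: "\<And>i j. \<lbrakk>i \<in> I; j \<in> I; i \<noteq> j\<rbrakk> \<Longrightarrow> pi_star (H i) (U i) \<inter> pi_star (H j) (U j) = {}"
    and D: "subgroup D P" "openin TP D" and d: "d \<in> D" and i: "i \<in> I"
  shows "single i (d i) \<in> D"
proof -
  interpret P: group P by (rule group_P)
  have dP: "d \<in> carrier P" using d D subgroup.subset by blast
  have dj: "d j \<in> carrier (H j)" if "j \<in> I" for j using dP that by auto
  \<comment> \<open>With \<open>N j\<close> inside the part of \<open>D\<close> in the factor, any
    element whose coordinates all lie in the \<open>N j\<close> belongs to \<open>D\<close>; errors
    of this size may be ignored.\<close>
  have "\<exists>N. N \<lhd> H j \<and> openin (U j) N \<and> N \<subseteq> fac D j" if "j \<in> I" for j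
    using profinite_group.open_normal_subgroup_below[OF profinite[OF that] part_open_subgroup(2)[OF D that]]
      subgroup.one_closed[OF part_open_subgroup(1)[OF D that]] by metis
  then obtain N where N: "\<And>j. j \<in> I \<Longrightarrow> N j \<lhd> H j" "\<And>j. j \<in> I \<Longrightarrow> openin (U j) (N j)"
      "\<And>j. j \<in> I \<Longrightarrow> N j \<subseteq> fac D j" by metis
  define m where "m j = group.ord (H j Mod N j) (N j #>\<^bsub>H j\<^esub> d j)" for j
  have m0: "m j > 0" if "j \<in> I" for j
    unfolding m_def using profinite_group.ord_modulo_open(1)[OF profinite[OF that] N(1,2)[OF that] dj[OF that]] .
  have mN: "d j [^]\<^bsub>H j\<^esub> k \<in> N j \<longleftrightarrow> m j dvd k" if "j \<in> I" for j and k :: nat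
    unfolding m_def using group.pow_in_normal_iff_ord_dvd[OF group_factor[OF that] N(1)[OF that] dj[OF that]] .
  have cop: "coprime (m j) (m i)" if j: "j \<in> I" "j \<noteq> i" for j
  proof (rule ccontr)
    assume "\<not> coprime (m j) (m i)"
    then obtain p where p: "prime p" "p dvd m j" "p dvd m i"
      using m0[OF i] by (metis coprime_iff_gcd_eq_1 gcd_greatest_iff prime_factor_nat)
    have "p \<in> pi_star (H k) (U k)" if "k \<in> I" "p dvd m k" for k
      using profinite_group.prime_dvd_order_in_pi_star[OF profinite N(1,2) dj p(1)] that unfolding m_def by blast
    then show False using disj[OF j(1) i j(2)] p j(1) i by blast
  qed
  \<comment> \<open>The exponent \<open>M * a\<close> is divisible by \<open>m j\<close> for every j
    other than \<open>i\<close>, and is congruent to 1 modulo \<open>m i\<close>.\<close>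
  define M where "M = prod m (I - {i})"
  have "M \<noteq> 0" unfolding M_def using m0 finite_index by auto
  then obtain a b where "M * a = m i * b + gcd M (m i)" using bezout_nat by blast
  moreover have "coprime M (m i)" unfolding M_def using cop by (intro prod_coprime_left) auto
  ultimately have e: "M * a = Suc (m i * b)" by (simp add: coprime_iff_gcd_eq_1)
  let ?e = "M * a" and ?s = "single i (d i)"
  have sP: "?s \<in> carrier P" using single_hom[OF i] dj[OF i] by (auto simp: hom_def)
  \<comment> \<open>The quotient of the power by the wanted element is the error. At
    \<open>i\<close> it is a power of \<open>d i\<close> with exponent divisible by
    \<open>m i\<close>, elsewhere a power of \<open>d j\<close> with exponent divisible by
    \<open>m j\<close>, so it lies in \<open>D\<close>.\<close>
  let ?y = "d [^]\<^bsub>P\<^esub> ?e \<otimes>\<^bsub>P\<^esub> inv\<^bsub>P\<^esub> ?s"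
  have inv_s: "(inv\<^bsub>P\<^esub> ?s) j = inv\<^bsub>H j\<^esub> (?s j)" if "j \<in> I" for j
    using sP that by (simp add: group_factor)
  have eP: "d [^]\<^bsub>P\<^esub> ?e \<in> carrier P" by (rule P.nat_pow_closed[OF dP])
  have yP: "?y \<in> carrier P" by (rule P.m_closed[OF eP P.inv_closed[OF sP]])
  have "?y j \<in> N j" if j: "j \<in> I" for j
  proof -
    interpret Hj: group "H j" using group_factor[OF j] .
    have yj: "?y j = d j [^]\<^bsub>H j\<^esub> ?e \<otimes>\<^bsub>H j\<^esub> inv\<^bsub>H j\<^esub> (?s j)"
      using j inv_s nat_pow_product[OF j] by (simp del: inv_product_group)
    show ?thesis
    proof (cases "j = i")
      case True
      note yj
      also have "d j [^]\<^bsub>H j\<^esub> ?e \<otimes>\<^bsub>H j\<^esub> inv\<^bsub>H j\<^esub> (?s j) = d j [^]\<^bsub>H j\<^esub> (m j * b)"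
        unfolding e using j dj[OF j] by (simp add: single_coordinate_def Hj.m_assoc True[symmetric])
      finally show ?thesis using mN[OF j] by (simp only: dvd_triv_left)
    next
      case False
      then have "m j dvd M" unfolding M_def using j finite_index by (intro dvd_prodI) auto
      then have "d j [^]\<^bsub>H j\<^esub> ?e \<in> N j" by (simp only: mN[OF j] dvd_mult2)
      moreover have "d j [^]\<^bsub>H j\<^esub> ?e \<otimes>\<^bsub>H j\<^esub> inv\<^bsub>H j\<^esub> (?s j) = d j [^]\<^bsub>H j\<^esub> ?e"
        using False j dj[OF j] by (simp add: single_coordinate_def)
      ultimately show ?thesis using yj by (simp only:)
    qed
  qed
  then have yD: "?y \<in> D"
    using N(3) unfolding coordinate_part_def by (intro mem_subgroup_if_singles[OF D(1) yP]) blast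
  have "d [^]\<^bsub>P\<^esub> k \<in> D" for k :: nat
    by (induction k)
      (simp_all add: subgroup.one_closed[OF D(1)] subgroup.m_closed[OF D(1) _ d]
        del: one_product_group mult_product_group)
  then have "d [^]\<^bsub>P\<^esub> ?e \<in> D" .
  then have "inv\<^bsub>P\<^esub> ?y \<otimes>\<^bsub>P\<^esub> d [^]\<^bsub>P\<^esub> ?e \<in> D"
    using yD D(1) subgroup.m_closed subgroup.m_inv_closed by metis
  moreover have "inv\<^bsub>P\<^esub> ?y \<otimes>\<^bsub>P\<^esub> d [^]\<^bsub>P\<^esub> ?e = ?s"
    using P.inv_mult_group[OF eP P.inv_closed[OF sP]] P.m_assoc[OF sP P.inv_closed[OF eP] eP]
      P.inv_inv[OF sP] P.l_inv[OF eP] P.r_one[OF sP] by metis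
  ultimately show ?thesis by metis
qed

text \<open>Taking coordinate parts and forming \<open>PiE\<close> are mutually inverse and
  monotone. Disjointness of the prime sets enters in fact \<open>1\<close>, which needs the
  coordinates of an element of \<open>D\<close> to lie in \<open>D\<close> themselves.\<close>

lemma order_iso_product_open_subgroups:
  assumes disj: "\<And>i j. \<lbrakk>i \<in> I; j \<in> I; i \<noteq> j\<rbrakk> \<Longrightarrow> pi_star (H i) (U i) \<inter> pi_star (H j) (U j) = {}"
  shows "order_iso (open_subgroup_lattice P TP)
    (product_lattice I (\<lambda>i. open_subgroup_lattice (H i) (U i)))"
proof -
  let ?A = "{D. subgroup D P \<and> openin TP D}"
    and ?B = "\<Pi>\<^sub>E i\<in>I. {X. subgroup X (H i) \<and> openin (U i) X}"
    and ?f = "\<lambda>D. \<lambda>i\<in>I. fac D i"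
  have 1: "PiE I (fac D) = D" if D: "D \<in> ?A" for D
  proof (intro equalityI subsetI)
    fix x assume x: "x \<in> PiE I (fac D)"
    then have "x \<in> carrier P" by (auto simp: coordinate_part_def)
    moreover have "single i (x i) \<in> D" if "i \<in> I" for i
      using PiE_mem[OF x that] by (simp add: coordinate_part_def)
    ultimately show "x \<in> D" using mem_subgroup_if_singles D by blast
  next
    fix d assume d: "d \<in> D"
    then have dP: "d \<in> carrier P" using D subgroup.subset by blast
    moreover have "single i (d i) \<in> D" if "i \<in> I" for i
      using single_mem_open_subgroup[OF disj _ _ d that] D by blast
    ultimately show "d \<in> PiE I (fac D)" by (auto simp: coordinate_part_def PiE_iff)
  qed
  have 2: "fac (PiE I Y) i = Y i" if Y: "Y \<in> ?B" and i: "i \<in> I" for Y i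
  proof -
    have "Y i \<subseteq> carrier (H i)" using Y i subgroup.subset by (auto simp: PiE_iff)
    moreover have "\<one>\<^bsub>H j\<^esub> \<in> Y j" if "j \<in> I" for j using Y that by (auto simp: PiE_iff subgroup.one_closed)
    ultimately show ?thesis using i by (auto simp: coordinate_part_def single_coordinate_def PiE_iff)
  qed
  have 3: "PiE I Y \<in> ?A" if Y: "Y \<in> ?B" for Y
  proof -
    have "subgroup (PiE I Y) P" using Y group_factor by (subst PiE_subgroup_product_group) (auto simp: PiE_iff)
    moreover have "openin TP (PiE I Y)" using Y finite_index by (subst openin_PiE_gen) (auto simp: PiE_iff)
    ultimately show ?thesis by blast
  qed
  have cong: "PiE I (\<lambda>i\<in>I. fac D i) = PiE I (fac D)" for D by (rule PiE_cong) simp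
  have "bij_betw ?f ?A ?B"
  proof (rule bij_betw_byWitness[where f' = "PiE I"])
    show "\<forall>D\<in>?A. PiE I (?f D) = D" using 1 cong by simp
    show "\<forall>Y\<in>?B. ?f (PiE I Y) = Y" using 2 by (auto simp: fun_eq_iff PiE_iff extensional_def)
    show "?f ` ?A \<subseteq> ?B" using part_open_subgroup by auto
    show "PiE I ` ?B \<subseteq> ?A" using 3 by blast
  qed
  moreover have "(\<forall>i\<in>I. ?f D i \<subseteq> ?f E i) \<longleftrightarrow> D \<subseteq> E" if "D \<in> ?A" "E \<in> ?A" for D E
  proof
    assume "\<forall>i\<in>I. ?f D i \<subseteq> ?f E i"
    then have "PiE I (fac D) \<subseteq> PiE I (fac E)" by (intro PiE_mono) simp
    then show "D \<subseteq> E" using 1 that by simp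
  qed (auto simp: coordinate_part_def)
  ultimately show ?thesis
    unfolding order_iso_def
    by (intro exI[of _ ?f]) (simp add: open_subgroup_lattice_def product_lattice_def)
qed

end

lemma order_iso_if_product_decomposition:
  fixes H :: "'i \<Rightarrow> ('a, 'm) monoid_scheme"
  assumes G: "profinite_group G T" and I: "finite I"
    and H: "\<And>i. i \<in> I \<Longrightarrow> profinite_group (H i) (U i)"
    and L: "\<And>i. i \<in> I \<Longrightarrow> order_iso (open_subgroup_lattice (H i) (U i)) (L i)"
    and disj: "\<And>i j. \<lbrakk>i \<in> I; j \<in> I; i \<noteq> j\<rbrakk> \<Longrightarrow> pi_star (H i) (U i) \<inter> pi_star (H j) (U j) = {}"
    and GP: "topological_group_iso G T (product_group I H) (product_topology U I)"
  shows "order_iso (open_subgroup_lattice G T) (product_lattice I L)"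
proof -
  interpret profinite_group G T by (rule G)
  interpret F: profinite_family I H U by (rule profinite_family.intro[OF I H])
  have "topspace (product_topology U I) = carrier (product_group I H)"
    using F.topspace_factor by (auto simp: PiE_iff)
  from order_iso_open_subgroups[OF GP group_axioms F.group_P topspace_eq this]
  show ?thesis
    using F.order_iso_product_open_subgroups[OF disj] order_iso_product_lattice[of I, OF L]
    by (meson order_iso_trans)
qed

section \<open>Internal direct decompositions\<close>

context topological_group
begin

text \<open>The set is the conjugate of \<open>X\<close> by \<open>a\<close>, written as a preimage
  so that openness follows from continuity.\<close>

lemma open_conjugate:
  assumes X: "subgroup X G" "openin T X" and a: "a \<in> carrier G"
  shows "subgroup {y \<in> carrier G. inv a \<otimes> y \<otimes> a \<in> X} G"
    and "openin T {y \<in> carrier G. inv a \<otimes> y \<otimes> a \<in> X}"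
proof -
  have XG: "X \<subseteq> carrier G" using X subgroup.subset by blast
  show "subgroup {y \<in> carrier G. inv a \<otimes> y \<otimes> a \<in> X} G"
  proof (rule subgroupI)
    have "inv a \<otimes> \<one> \<otimes> a \<in> X" using a subgroup.one_closed[OF X(1)] by simp
    then show "{y \<in> carrier G. inv a \<otimes> y \<otimes> a \<in> X} \<noteq> {}" by blast
    fix y assume y: "y \<in> {y \<in> carrier G. inv a \<otimes> y \<otimes> a \<in> X}"
    then have "inv (inv a \<otimes> y \<otimes> a) \<in> X" using subgroup.m_inv_closed[OF X(1)] by blast
    moreover have "inv (inv a \<otimes> y \<otimes> a) = inv a \<otimes> inv y \<otimes> a"
      using a y by (simp add: inv_mult_group m_assoc)
    ultimately show "inv y \<in> {y \<in> carrier G. inv a \<otimes> y \<otimes> a \<in> X}" using y by simp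
    fix z assume z: "z \<in> {y \<in> carrier G. inv a \<otimes> y \<otimes> a \<in> X}"
    have "(inv a \<otimes> y \<otimes> a) \<otimes> (inv a \<otimes> z \<otimes> a) = inv a \<otimes> (y \<otimes> z) \<otimes> a"
      using a y z by (simp add: m_assoc) (metis inv_closed l_one m_assoc m_closed r_inv)
    moreover have "(inv a \<otimes> y \<otimes> a) \<otimes> (inv a \<otimes> z \<otimes> a) \<in> X"
      using y z subgroup.m_closed[OF X(1)] by blast
    ultimately show "y \<otimes> z \<in> {y \<in> carrier G. inv a \<otimes> y \<otimes> a \<in> X}" using y z by simp
  qed auto
  have "continuous_map T T (\<lambda>y. inv a \<otimes> y \<otimes> a)"
    using a by (intro continuous_map_mult) (simp_all add: topspace_eq continuous_map_id[unfolded id_def])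
  from openin_continuous_map_preimage[OF this X(2)]
  show "openin T {y \<in> carrier G. inv a \<otimes> y \<otimes> a \<in> X}" by (simp add: topspace_eq)
qed

text \<open>Conjugating \<open>A\<close> by an element of \<open>B\<close> does not change the join of \<open>A\<close> and \<open>B\<close>; so \<open>B\<close> normalizes \<open>A\<close>
  as soon as \<open>A\<close> is the least open subgroup above \<open>N\<close> that generates the whole group together with \<open>B\<close>.\<close>

lemma normal_if_least_supplement:
  assumes A: "subgroup A G" "openin T A" and B: "subgroup B G"
    and N: "N \<lhd> G" "N \<subseteq> A"
    and supp: "\<And>K. \<lbrakk>subgroup K G; openin T K; A \<subseteq> K; B \<subseteq> K\<rbrakk> \<Longrightarrow> K = carrier G"
    and least: "\<And>X. \<lbrakk>subgroup X G; openin T X; N \<subseteq> X;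
        \<And>K. \<lbrakk>subgroup K G; openin T K; X \<subseteq> K; B \<subseteq> K\<rbrakk> \<Longrightarrow> K = carrier G\<rbrakk> \<Longrightarrow> A \<subseteq> X"
  shows "A \<lhd> G"
proof -
  have AG: "A \<subseteq> carrier G" and BG: "B \<subseteq> carrier G" using A B subgroup.subset by blast+
  have NG: "N \<subseteq> carrier G" using AG N by blast
  have 1: "inv b \<otimes> a \<otimes> b \<in> A" if b: "b \<in> B" and a: "a \<in> A" for a b
  proof -
    have bG: "b \<in> carrier G" using b BG by blast
    let ?X = "{y \<in> carrier G. inv b \<otimes> y \<otimes> b \<in> A}"
    \<comment> \<open>Minimality of \<open>A\<close> is applied to its own conjugate: a subgroup
      \<open>K\<close> that contains this conjugate and \<open>B\<close> can conjugate back by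
      \<open>b\<close>, hence contains \<open>A\<close> as well.\<close>
    have "A \<subseteq> ?X"
    proof (rule least)
      show "subgroup ?X G" "openin T ?X" using open_conjugate[OF A bG] by auto
      show "N \<subseteq> ?X" using normal.inv_op_closed1[OF N(1) bG] N(2) NG by blast
      fix K assume K: "subgroup K G" "openin T K" "?X \<subseteq> K" "B \<subseteq> K"
      have "A \<subseteq> K"
      proof
        fix c assume c: "c \<in> A"
        then have cG: "c \<in> carrier G" using AG by blast
        have "inv b \<otimes> (b \<otimes> c \<otimes> inv b) \<otimes> b = c"
          using bG cG by (simp add: m_assoc) (metis inv_closed l_inv l_one m_assoc)
        then have "b \<otimes> c \<otimes> inv b \<in> K" using K(3) c bG cG by auto
        then have "inv b \<otimes> (b \<otimes> c \<otimes> inv b) \<otimes> b \<in> K"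
          using K b by (meson subgroup.m_closed subgroup.m_inv_closed subsetD)
        then show "c \<in> K" using \<open>inv b \<otimes> (b \<otimes> c \<otimes> inv b) \<otimes> b = c\<close> by simp
      qed
      then show "K = carrier G" using supp K by blast
    qed
    then show ?thesis using a by blast
  qed
  \<comment> \<open>The normalizer of \<open>A\<close>, with both directions of conjugation so that
    closure under inverses is immediate. It contains \<open>A\<close>, hence is open, and it
    contains \<open>B\<close>, so \<open>supp\<close> makes it the whole group.\<close>
  let ?K = "{x \<in> carrier G. \<forall>a\<in>A. inv x \<otimes> a \<otimes> x \<in> A \<and> x \<otimes> a \<otimes> inv x \<in> A}"
  have K: "subgroup ?K G"
  proof (rule subgroupI)
    have "\<one> \<in> ?K" using AG by (auto simp: subset_iff)
    then show "?K \<noteq> {}" by blast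
    fix x assume x: "x \<in> ?K"
    then show "inv x \<in> ?K" by simp
    fix y assume y: "y \<in> ?K"
    have "inv (x \<otimes> y) \<otimes> a \<otimes> (x \<otimes> y) = inv y \<otimes> (inv x \<otimes> a \<otimes> x) \<otimes> y"
      "(x \<otimes> y) \<otimes> a \<otimes> inv (x \<otimes> y) = x \<otimes> (y \<otimes> a \<otimes> inv y) \<otimes> inv x" if "a \<in> A" for a
      using x y that AG by (simp_all add: inv_mult_group m_assoc subset_iff)
    then show "x \<otimes> y \<in> ?K" using x y by simp
  qed auto
  have AK: "A \<subseteq> ?K"
    using A(1) AG by (auto simp: subgroup.m_closed subgroup.m_inv_closed)
  moreover have "B \<subseteq> ?K"
  proof
    fix b assume b: "b \<in> B"
    then have "inv b \<in> B" "b \<in> carrier G" using B BG by (auto simp: subgroup.m_inv_closed)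
    then show "b \<in> ?K" using 1[OF b] 1[of "inv b"] by simp
  qed
  ultimately have "?K = carrier G" by (intro supp K openin_subgroup_mono[OF A K])
  then show "A \<lhd> G" by (intro normal_invI[OF A(1)]) blast
qed

end

context group
begin

text \<open>Modulo \<open>N\<close> the element \<open>u\<close> has order p. If a power of
  \<open>u\<close> with exponent prime to p were in \<open>A\<close>, a Bezout relation would put
  \<open>u\<close> itself into \<open>A\<close>.\<close>

lemma cyclic_extension_Int:
  assumes N: "N \<lhd> G" and A: "subgroup A G" "N \<subseteq> A" and u: "u \<in> carrier G" "u \<notin> A"
    and p: "prime p" "u [^] (p::nat) \<in> N"
  shows "(N <#> generate G {u}) \<inter> A \<subseteq> N"
proof
  fix x assume x: "x \<in> (N <#> generate G {u}) \<inter> A"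
  have sN: "subgroup N G" using N by (simp add: normal_imp_subgroup)
  obtain n and k :: int where nk: "n \<in> N" "x = n \<otimes> u [^] k"
    using x u(1) by (auto simp: set_mult_def generate_pow)
  have nG: "n \<in> carrier G" using nk sN subgroup.subset by blast
  have "inv n \<otimes> x \<in> A"
    using x nk A by (auto intro!: subgroup.m_closed subgroup.m_inv_closed)
  moreover have "inv n \<otimes> x = u [^] k" unfolding nk using nG u by (simp add: m_assoc[symmetric])
  ultimately have ukA: "u [^] k \<in> A" by simp
  have up: "u [^] int p \<in> N" using p(2) by (simp add: int_pow_int)
  have "int p dvd k"
  proof (rule ccontr)
    assume "\<not> int p dvd k"
    then have "coprime k (int p)" using p(1) prime_imp_coprime[of "int p" k] by (simp add: coprime_commute)
    then obtain s t where st: "s * k + t * int p = 1" using bezout_int[of k "int p"] by auto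
    have "u [^] (s * k + t * int p) = (u [^] k) [^] s \<otimes> (u [^] int p) [^] t"
      using u(1) by (simp add: int_pow_mult int_pow_pow mult.commute)
    also have "\<dots> \<in> A"
      by (intro subgroup.m_closed[OF A(1)] subgroup_int_pow_closed[OF A(1) ukA]
          subgroup_int_pow_closed[OF A(1) subsetD[OF A(2) up]])
    finally show False using st u by simp
  qed
  then obtain q where "k = int p * q" by blast
  then have "u [^] k = (u [^] int p) [^] q" using u(1) by (simp add: int_pow_pow)
  then have "u [^] k \<in> N" using subgroup_int_pow_closed[OF sN up] by simp
  then show "x \<in> N" unfolding nk using nk(1) by (simp add: subgroup.m_closed[OF sN])
qed

end

section \<open>Topological direct decompositions\<close>

context profinite_group
begin

text \<open>The map picks the \<open>E\<close>-component. It is well determined because two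
  candidates differ by an element of \<open>E \<inter> C\<close>, and multiplicative because
  normality of \<open>C\<close> lets \<open>C\<close>-components move past
  \<open>E\<close>-components.\<close>

lemma projection_of_decomposition:
  assumes E: "E \<lhd> G" "closedin T E" and C: "C \<lhd> G" "closedin T C" and EC: "E \<inter> C \<subseteq> {\<one>}"
    and prod: "\<And>x. x \<in> carrier G \<Longrightarrow> \<exists>y\<in>E. inv y \<otimes> x \<in> C"
  obtains e where "e \<in> hom G (G\<lparr>carrier := E\<rparr>)" "continuous_map T (subtopology T E) e"
    "\<And>x. x \<in> E \<Longrightarrow> e x = x" "\<And>x. x \<in> carrier G \<Longrightarrow> inv (e x) \<otimes> x \<in> C"
    "\<And>x. x \<in> C \<Longrightarrow> e x = \<one>"
proof -
  have sE: "subgroup E G" and sC: "subgroup C G" using E C by (simp_all add: normal_imp_subgroup)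
  have EG: "E \<subseteq> carrier G" and CG: "C \<subseteq> carrier G" using sE sC subgroup.subset by blast+
  obtain e where e: "\<And>x. x \<in> carrier G \<Longrightarrow> e x \<in> E" "\<And>x. x \<in> carrier G \<Longrightarrow> inv (e x) \<otimes> x \<in> C"
    using prod by metis
  have uniq: "e x = y" if "x \<in> carrier G" "y \<in> E" "inv y \<otimes> x \<in> C" for x y
  proof -
    have yG: "y \<in> carrier G" and exG: "e x \<in> carrier G" using that e EG by auto
    have "(inv y \<otimes> x) \<otimes> inv (inv (e x) \<otimes> x) \<in> C"
      using that e sC by (meson subgroup.m_closed subgroup.m_inv_closed)
    moreover have "(inv y \<otimes> x) \<otimes> inv (inv (e x) \<otimes> x) = inv y \<otimes> e x"
      using yG exG that(1) by (simp add: inv_mult_group m_assoc) (metis inv_closed l_one m_assoc r_inv)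
    moreover have "inv y \<otimes> e x \<in> E"
      using that e sE by (meson subgroup.m_closed subgroup.m_inv_closed)
    ultimately have "inv y \<otimes> e x = \<one>" using EC by auto
    then show ?thesis using yG exG by (metis inv_closed inv_equality inv_inv)
  qed
  have "e \<in> hom G (G\<lparr>carrier := E\<rparr>)"
  proof (rule homI)
    fix x y assume xy: "x \<in> carrier G" "y \<in> carrier G"
    have c: "e x \<in> carrier G" "e y \<in> carrier G" using xy e EG by auto
    have "inv (e y) \<otimes> (inv (e x) \<otimes> x) \<otimes> e y \<in> C"
      using normal.inv_op_closed1[OF C(1) c(2)] e(2)[OF xy(1)] by blast
    then have "(inv (e y) \<otimes> (inv (e x) \<otimes> x) \<otimes> e y) \<otimes> (inv (e y) \<otimes> y) \<in> C"
      using e(2)[OF xy(2)] by (simp add: subgroup.m_closed[OF sC])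
    moreover have "(inv (e y) \<otimes> (inv (e x) \<otimes> x) \<otimes> e y) \<otimes> (inv (e y) \<otimes> y) = inv (e x \<otimes> e y) \<otimes> (x \<otimes> y)"
    proof -
      have "e y \<otimes> (inv (e y) \<otimes> y) = y" using xy c by (simp add: m_assoc[symmetric])
      then show ?thesis using xy c by (simp add: m_assoc inv_mult_group)
    qed
    ultimately have "inv (e x \<otimes> e y) \<otimes> (x \<otimes> y) \<in> C" by simp
    then show "e (x \<otimes> y) = e x \<otimes>\<^bsub>G\<lparr>carrier := E\<rparr>\<^esub> e y"
      using uniq xy e sE by (simp add: subgroup.m_closed)
  qed (use e in simp)
  moreover have "continuous_map T (subtopology T E) e"
    unfolding continuous_map_closedin
  proof (intro conjI allI impI)
    show "e \<in> topspace T \<rightarrow> topspace (subtopology T E)"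
      using e EG by (auto simp: topspace_eq)
    fix D assume D: "closedin (subtopology T E) D"
    then have DE: "D \<subseteq> E" "closedin T D"
      using closedin_subset[OF D] closedin_trans_full[OF D E(2)] by auto
    \<comment> \<open>The preimage of a closed \<open>D\<close> is the product set of
      \<open>D\<close> and \<open>C\<close>, an image of a compact set and therefore closed.\<close>
    have "{x \<in> topspace T. e x \<in> D} = (\<lambda>(x, y). x \<otimes> y) ` (D \<times> C)"
    proof (intro equalityI subsetI)
      fix x assume x: "x \<in> {x \<in> topspace T. e x \<in> D}"
      then have "x = e x \<otimes> (inv (e x) \<otimes> x)"
        using e(1) EG by (auto simp: topspace_eq m_assoc[symmetric] subset_iff)
      then show "x \<in> (\<lambda>(x, y). x \<otimes> y) ` (D \<times> C)"
        using x e(2) by (intro image_eqI[of _ _ "(e x, inv (e x) \<otimes> x)"]) (auto simp: topspace_eq)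
    next
      fix x assume "x \<in> (\<lambda>(x, y). x \<otimes> y) ` (D \<times> C)"
      then obtain d c where dc: "d \<in> D" "c \<in> C" "x = d \<otimes> c" by auto
      then have G: "d \<in> carrier G" "c \<in> carrier G" using DE EG CG by auto
      then have "inv d \<otimes> x \<in> C" using dc by (simp add: m_assoc[symmetric])
      then have "e x = d" using uniq dc G DE by blast
      then show "x \<in> {x \<in> topspace T. e x \<in> D}" using dc G by (simp add: topspace_eq)
    qed
    moreover have "compactin T ((\<lambda>(x, y). x \<otimes> y) ` (D \<times> C))"
      by (rule image_compactin[OF _ continuous_mult])
        (simp add: compactin_Times closedin_compact_space[OF compact] DE C)
    ultimately show "closedin T {x \<in> topspace T. e x \<in> D}"
      using compactin_imp_closedin[OF Hausdorff] by simp
  qed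
  moreover have "e x = x" if "x \<in> E" for x
    using that EG by (intro uniq) (auto simp: subgroup.one_closed[OF sC] subset_iff)
  moreover have "e x = \<one>" if "x \<in> C" for x
    using that CG by (intro uniq) (auto simp: subgroup.one_closed[OF sE] subset_iff)
  ultimately show ?thesis using that e(2) by blast
qed

text \<open>Combine the projections to the \<open>E i\<close>. An element killed by all of them lies
  in every \<open>C i\<close>, which gives injectivity; the projection to \<open>E j\<close> kills
  the other \<open>E i\<close>, so all single-coordinate elements are attained. A continuous
  bijection from a compact to a Hausdorff space is a homeomorphism.\<close>

lemma topological_group_iso_product:
  assumes I: "finite I"
    and E: "\<And>i. i \<in> I \<Longrightarrow> E i \<lhd> G" "\<And>i. i \<in> I \<Longrightarrow> closedin T (E i)"
    and C: "\<And>i. i \<in> I \<Longrightarrow> C i \<lhd> G" "\<And>i. i \<in> I \<Longrightarrow> closedin T (C i)"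
    and EC: "\<And>i. i \<in> I \<Longrightarrow> E i \<inter> C i \<subseteq> {\<one>}"
    and prod: "\<And>i x. i \<in> I \<Longrightarrow> x \<in> carrier G \<Longrightarrow> \<exists>y\<in>E i. inv y \<otimes> x \<in> C i"
    and sub: "\<And>i j. \<lbrakk>i \<in> I; j \<in> I; i \<noteq> j\<rbrakk> \<Longrightarrow> E i \<subseteq> C j"
    and inter: "\<And>x. \<lbrakk>x \<in> carrier G; \<And>i. i \<in> I \<Longrightarrow> x \<in> C i\<rbrakk> \<Longrightarrow> x = \<one>"
  shows "topological_group_iso G T (product_group I (\<lambda>i. G\<lparr>carrier := E i\<rparr>))
    (product_topology (\<lambda>i. subtopology T (E i)) I)"
proof -
  let ?H = "\<lambda>i. G\<lparr>carrier := E i\<rparr>" and ?U = "\<lambda>i. subtopology T (E i)"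
  have EG: "E i \<subseteq> carrier G" if "i \<in> I" for i
    using E(1)[OF that] by (simp add: normal_imp_subgroup subgroup.subset)
  interpret F: profinite_family I ?H ?U
    by (rule profinite_family.intro[OF I])
      (use E in \<open>simp add: profinite_group_closed_subgroup normal_imp_subgroup\<close>)
  let ?proj = "\<lambda>i e. e \<in> hom G (?H i) \<and> continuous_map T (?U i) e \<and> (\<forall>x\<in>E i. e x = x) \<and>
      (\<forall>x\<in>carrier G. inv (e x) \<otimes> x \<in> C i) \<and> (\<forall>x\<in>C i. e x = \<one>)"
  have "\<forall>i\<in>I. \<exists>e. ?proj i e"
    using projection_of_decomposition[OF E C EC prod] by metis
  then obtain e where "\<forall>i\<in>I. ?proj i (e i)" by (rule bchoice[THEN exE])
  then have e: "\<And>i. i \<in> I \<Longrightarrow> e i \<in> hom G (?H i)"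
      "\<And>i. i \<in> I \<Longrightarrow> continuous_map T (?U i) (e i)" "\<And>i x. i \<in> I \<Longrightarrow> x \<in> E i \<Longrightarrow> e i x = x"
      "\<And>i x. i \<in> I \<Longrightarrow> x \<in> carrier G \<Longrightarrow> inv (e i x) \<otimes> x \<in> C i"
      "\<And>i x. i \<in> I \<Longrightarrow> x \<in> C i \<Longrightarrow> e i x = \<one>"
    by simp_all
  have eE: "e i x \<in> E i" if "i \<in> I" "x \<in> carrier G" for i x
    using e(1)[OF that(1)] that(2) by (auto simp: hom_def)
  define f where "f x = (\<lambda>i\<in>I. e i x)" for x
  have fP: "f x \<in> carrier F.P" if "x \<in> carrier G" for x
    using that eE by (auto simp: f_def)
  have hom: "f \<in> hom G F.P"
  proof (rule homI)
    fix x y assume xy: "x \<in> carrier G" "y \<in> carrier G"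
    then show "f (x \<otimes> y) = f x \<otimes>\<^bsub>F.P\<^esub> f y"
      using e(1) unfolding f_def mult_product_group by (intro restrict_ext) (simp add: hom_def)
  qed (rule fP)
  interpret f: group_hom G F.P f
    by (intro group_hom.intro group_hom_axioms.intro group_axioms F.group_P hom)
  have "continuous_map T F.TP f"
    using e(2) unfolding continuous_map_componentwise f_def by auto
  moreover have inj: "inj_on f (carrier G)"
  proof (rule f.inj_on_one_iff[THEN iffD2], intro allI impI)
    fix x assume x: "x \<in> carrier G" "f x = \<one>\<^bsub>F.P\<^esub>"
    show "x = \<one>"
    proof (rule inter[OF x(1)])
      fix i assume i: "i \<in> I"
      then have "e i x = \<one>" using fun_cong[OF x(2), of i] by (simp add: f_def)
      then show "x \<in> C i" using e(4)[OF i x(1)] x(1) by simp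
    qed
  qed
  moreover have surj: "f ` carrier G = carrier F.P"
  proof
    have s: "subgroup (f ` carrier G) F.P" by (rule f.img_is_subgroup)
    show "carrier F.P \<subseteq> f ` carrier G"
    proof
      fix y assume y: "y \<in> carrier F.P"
      show "y \<in> f ` carrier G"
      proof (rule F.mem_subgroup_if_singles[OF s y])
        fix i assume i: "i \<in> I"
        then have yi: "y i \<in> E i" using y by auto
        have "e j (y i) = \<one>" if "j \<in> I" "j \<noteq> i" for j
          using e(5)[OF that(1)] sub[OF i that(1)] that(2) yi by blast
        then have "single_coordinate I ?H i (y i) = f (y i)"
          unfolding single_coordinate_def f_def
          by (intro restrict_ext) (simp add: e(3)[OF i yi])
        then show "single_coordinate I ?H i (y i) \<in> f ` carrier G" using yi EG[OF i] by blast
      qed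
    qed
  qed (use fP in blast)
  moreover have topP: "topspace F.TP = carrier F.P"
    using F.topspace_factor by (auto simp: PiE_iff)
  moreover have "Hausdorff_space F.TP"
    using Hausdorff by (auto simp: Hausdorff_space_product_topology Hausdorff_space_subtopology)
  ultimately have "homeomorphic_map T F.TP f"
    using compact by (intro continuous_imp_homeomorphic_map) (simp_all add: topspace_eq)
  moreover have "f \<in> iso G F.P" using hom inj surj by (simp add: iso_def bij_betw_def)
  ultimately show ?thesis unfolding topological_group_iso_def by blast
qed

text \<open>The proof of disjointness of the prime sets only uses this finitary trace of a pro-\<open>p\<close> subgroup.\<close>

lemma pi_star_closed_subgroupE:
  assumes E: "subgroup E G" "closedin T E"
    and p: "p \<in> pi_star (G\<lparr>carrier := E\<rparr>) (subtopology T E)"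
  obtains x where "x \<in> E" "x \<noteq> \<one>" "\<And>N. N \<lhd> G \<Longrightarrow> openin T N \<Longrightarrow> \<exists>k. x [^] (p ^ k) \<in> N"
proof -
  obtain H where H: "subgroup H (G\<lparr>carrier := E\<rparr>)" "H \<noteq> {\<one>}"
      "pro_p_group (G\<lparr>carrier := H\<rparr>) (subtopology (subtopology T E) H) p"
    using p unfolding pi_star_def by auto
  have HE: "H \<subseteq> E" using subgroup.subset[OF H(1)] by simp
  have sH: "subgroup H G" using incl_subgroup[OF E(1) H(1)] .
  have "subtopology (subtopology T E) H = subtopology T H"
    using HE by (simp add: subtopology_subtopology Int_absorb1)
  then interpret H: pro_p_group "G\<lparr>carrier := H\<rparr>" "subtopology T H" p using H(3) by simp
  obtain x where x: "x \<in> H" "x \<noteq> \<one>" using H(2) subgroup.one_closed[OF sH] by blast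
  have "\<exists>k. x [^] (p ^ k) \<in> N" if N: "N \<lhd> G" "openin T N" for N
  proof -
    \<comment> \<open>The trace of \<open>N\<close> on \<open>H\<close> is open and normal there, so
      its index is a power of p, and Lagrange's theorem bounds the order of
      \<open>x\<close>.\<close>
    have K: "N \<inter> H \<lhd> G\<lparr>carrier := H\<rparr>" "openin (subtopology T H) (N \<inter> H)"
      using normal_Int_subgroup[OF sH N(1)] N(2) by (auto simp: openin_subtopology Int_commute)
    obtain k where k: "card (rcosets\<^bsub>G\<lparr>carrier := H\<rparr>\<^esub> (N \<inter> H)) = p ^ k" using H.index_power[OF K] by blast
    interpret K: normal "N \<inter> H" "G\<lparr>carrier := H\<rparr>" by (rule K(1))
    interpret Q: group "G\<lparr>carrier := H\<rparr> Mod (N \<inter> H)" by (rule K.factorgroup_is_group)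
    have "(N \<inter> H) #>\<^bsub>G\<lparr>carrier := H\<rparr>\<^esub> x \<in> carrier (G\<lparr>carrier := H\<rparr> Mod (N \<inter> H))"
      using x(1) unfolding FactGroup_def RCOSETS_def by auto
    from Q.ord_dvd_group_order[OF this]
    have "Q.ord ((N \<inter> H) #>\<^bsub>G\<lparr>carrier := H\<rparr>\<^esub> x) dvd p ^ k"
      using k by (simp add: order_def FactGroup_def)
    then have "x [^]\<^bsub>G\<lparr>carrier := H\<rparr>\<^esub> (p ^ k) \<in> N \<inter> H"
      using H.pow_in_normal_iff_ord_dvd[OF K(1), of x "p ^ k"] x(1) by simp
    then show ?thesis by (auto simp: nat_pow_consistent[symmetric])
  qed
  then show ?thesis using that x HE by blast
qed

text \<open>Stop one step before the iterated p-th powers of \<open>x\<close> first enter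
  \<open>N\<close>; the step exists because \<open>x\<close> itself, the power with exponent
  \<open>p ^ 0\<close>, is outside \<open>N\<close>.\<close>

lemma prime_power_torsion_modulo:
  assumes x: "x \<in> carrier G" "x \<notin> N" "\<exists>k. x [^] ((p::nat) ^ k) \<in> N"
  obtains k where "x [^] (p ^ k) \<notin> N" "(x [^] (p ^ k)) [^] p \<in> N"
proof -
  define k where "k = (LEAST k. x [^] (p ^ k) \<in> N)"
  have k: "x [^] (p ^ k) \<in> N" unfolding k_def using x(3) by (rule LeastI_ex)
  then have "k \<noteq> 0" using x by (metis nat_pow_eone power_0)
  then obtain l where l: "k = Suc l" by (meson not0_implies_Suc)
  have "x [^] (p ^ l) \<notin> N" using not_less_Least[of l "\<lambda>k. x [^] (p ^ k) \<in> N"] l unfolding k_def by auto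
  moreover have "(x [^] (p ^ l)) [^] p = x [^] (p ^ k)"
    using x(1) l by (simp add: nat_pow_pow mult.commute)
  ultimately show ?thesis using that k by metis
qed

end

section \<open>Decomposing the lattice of open subgroups\<close>

lemma (in group) subset_set_mult:
  assumes "subgroup M G" "subgroup N G"
  shows "M \<subseteq> M <#> N" "N \<subseteq> M <#> N"
proof -
  have M: "M \<subseteq> carrier G" "\<one> \<in> M" and N: "N \<subseteq> carrier G" "\<one> \<in> N"
    using assms by (auto simp: subgroup.subset subgroup.one_closed dest: subgroup.mem_carrier)
  show "M \<subseteq> M <#> N"
  proof
    fix x assume "x \<in> M"
    then have "x = x \<otimes> \<one>" using M by auto
    then show "x \<in> M <#> N" using \<open>x \<in> M\<close> N(2) unfolding set_mult_def by blast
  qed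
  show "N \<subseteq> M <#> N"
  proof
    fix x assume "x \<in> N"
    then have "x = \<one> \<otimes> x" using N by auto
    then show "x \<in> M <#> N" using \<open>x \<in> N\<close> M(2) unfolding set_mult_def by blast
  qed
qed

text \<open>The order isomorphism is given as a pair of mutually inverse maps, so that an open
  subgroup can be prescribed by its coordinates through \<open>g\<close> and examined through
  \<open>f\<close>.\<close>

locale open_subgroup_product = profinite_group G T
  for G :: "('a, 'n) monoid_scheme" (structure) and T +
  fixes I :: "'i set" and L :: "'i \<Rightarrow> ('b, 'm) gorder_scheme"
    and f :: "'a set \<Rightarrow> 'i \<Rightarrow> 'b" and g :: "('i \<Rightarrow> 'b) \<Rightarrow> 'a set"
  assumes finite_index: "finite I"
    and order: "\<And>i. i \<in> I \<Longrightarrow> partial_order (L i)"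
    and f_closed: "\<And>X. \<lbrakk>subgroup X G; openin T X\<rbrakk> \<Longrightarrow> f X \<in> (\<Pi>\<^sub>E i\<in>I. carrier (L i))"
    and g_subgroup: "\<And>x. x \<in> (\<Pi>\<^sub>E i\<in>I. carrier (L i)) \<Longrightarrow> subgroup (g x) G"
    and g_open: "\<And>x. x \<in> (\<Pi>\<^sub>E i\<in>I. carrier (L i)) \<Longrightarrow> openin T (g x)"
    and g_f: "\<And>X. \<lbrakk>subgroup X G; openin T X\<rbrakk> \<Longrightarrow> g (f X) = X"
    and f_g: "\<And>x. x \<in> (\<Pi>\<^sub>E i\<in>I. carrier (L i)) \<Longrightarrow> f (g x) = x"
    and f_le: "\<And>X Y. \<lbrakk>subgroup X G; openin T X; subgroup Y G; openin T Y\<rbrakk> \<Longrightarrow>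
      X \<subseteq> Y \<longleftrightarrow> (\<forall>i\<in>I. f X i \<sqsubseteq>\<^bsub>L i\<^esub> f Y i)"
begin

definition open_subgroup :: "'a set \<Rightarrow> bool" where "open_subgroup X \<longleftrightarrow> subgroup X G \<and> openin T X"

definition open_normal :: "'a set \<Rightarrow> bool" where "open_normal N \<longleftrightarrow> N \<lhd> G \<and> openin T N"

abbreviation "\<Lambda> \<equiv> \<Pi>\<^sub>E i\<in>I. carrier (L i)"

definition "\<tau> = f (carrier G)"

definition "A i N = g ((f N)(i := \<tau> i))"

definition "B i N = g (\<tau>(i := f N i))"

section \<open>Inclusions of open subgroups in coordinates\<close>

lemma open_subgroup_carrier: "open_subgroup (carrier G)"
  by (simp add: open_subgroup_def subgroup_self openin_carrier)

lemma open_normal_imp_open_subgroup: "open_normal N \<Longrightarrow> open_subgroup N"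
  by (simp add: open_subgroup_def open_normal_def normal_imp_subgroup)

lemma open_subgroup_subset: "open_subgroup X \<Longrightarrow> X \<subseteq> carrier G"
  by (simp add: open_subgroup_def subgroup.subset)

lemma open_subgroup_Int: "open_subgroup X \<Longrightarrow> open_subgroup Y \<Longrightarrow> open_subgroup (X \<inter> Y)"
  by (simp add: open_subgroup_def subgroups_Inter_pair openin_Int)

lemma open_subgroup_mono: "open_subgroup X \<Longrightarrow> subgroup Y G \<Longrightarrow> X \<subseteq> Y \<Longrightarrow> open_subgroup Y"
  by (auto simp: open_subgroup_def intro: openin_subgroup_mono)

lemma f_mem: "open_subgroup X \<Longrightarrow> f X \<in> \<Lambda>"
  by (simp add: open_subgroup_def f_closed)

lemma open_subgroup_g: "x \<in> \<Lambda> \<Longrightarrow> open_subgroup (g x)"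
  by (simp add: open_subgroup_def g_subgroup g_open)

lemma gf: "open_subgroup X \<Longrightarrow> g (f X) = X"
  by (simp add: open_subgroup_def g_f)

lemma subset_iff_f: "open_subgroup X \<Longrightarrow> open_subgroup Y \<Longrightarrow> X \<subseteq> Y \<longleftrightarrow> (\<forall>i\<in>I. f X i \<sqsubseteq>\<^bsub>L i\<^esub> f Y i)"
  by (simp add: open_subgroup_def f_le)

lemma subset_g_iff: "open_subgroup X \<Longrightarrow> y \<in> \<Lambda> \<Longrightarrow> X \<subseteq> g y \<longleftrightarrow> (\<forall>i\<in>I. f X i \<sqsubseteq>\<^bsub>L i\<^esub> y i)"
  by (simp add: subset_iff_f open_subgroup_g f_g)

lemma g_subset_iff: "x \<in> \<Lambda> \<Longrightarrow> open_subgroup Y \<Longrightarrow> g x \<subseteq> Y \<longleftrightarrow> (\<forall>i\<in>I. x i \<sqsubseteq>\<^bsub>L i\<^esub> f Y i)"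
  by (simp add: subset_iff_f open_subgroup_g f_g)

lemma f_coord: "open_subgroup X \<Longrightarrow> i \<in> I \<Longrightarrow> f X i \<in> carrier (L i)"
  using f_mem by blast

lemma le_refl: "i \<in> I \<Longrightarrow> u \<in> carrier (L i) \<Longrightarrow> u \<sqsubseteq>\<^bsub>L i\<^esub> u"
  using order partial_order.axioms(1) weak_partial_order.le_refl by metis

lemma le_antisym:
  "\<lbrakk>i \<in> I; u \<in> carrier (L i); v \<in> carrier (L i); u \<sqsubseteq>\<^bsub>L i\<^esub> v; v \<sqsubseteq>\<^bsub>L i\<^esub> u\<rbrakk> \<Longrightarrow> u = v"
  using order partial_order.le_antisym by metis

lemma top_mem: "\<tau> \<in> \<Lambda>"
  unfolding \<tau>_def by (rule f_mem[OF open_subgroup_carrier])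

lemma top_coord: "i \<in> I \<Longrightarrow> \<tau> i \<in> carrier (L i)"
  using top_mem by blast

lemma upd_mem: "x \<in> \<Lambda> \<Longrightarrow> i \<in> I \<Longrightarrow> u \<in> carrier (L i) \<Longrightarrow> x(i := u) \<in> \<Lambda>"
  by (auto simp: PiE_iff extensional_def)

text \<open>Compare \<open>G\<close> with the open subgroup that has \<open>u\<close> at the
  coordinate \<open>i\<close> and the top value elsewhere.\<close>

lemma le_top:
  assumes "i \<in> I" "u \<in> carrier (L i)" shows "u \<sqsubseteq>\<^bsub>L i\<^esub> \<tau> i"
proof -
  have m: "\<tau>(i := u) \<in> \<Lambda>" using assms top_mem upd_mem by blast
  have "g (\<tau>(i := u)) \<subseteq> carrier G" using open_subgroup_g[OF m] open_subgroup_subset by blast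
  then show ?thesis using g_subset_iff[OF m open_subgroup_carrier] assms(1) by (auto simp: \<tau>_def)
qed

lemma top_le_iff: "i \<in> I \<Longrightarrow> u \<in> carrier (L i) \<Longrightarrow> \<tau> i \<sqsubseteq>\<^bsub>L i\<^esub> u \<longleftrightarrow> u = \<tau> i"
  using le_top[of i u] le_antisym[of i u "\<tau> i"] le_refl[of i u] top_coord[of i] by blast

lemma eq_carrier_iff: "open_subgroup X \<Longrightarrow> X = carrier G \<longleftrightarrow> (\<forall>i\<in>I. f X i = \<tau> i)"
proof
  assume X: "open_subgroup X" and "\<forall>i\<in>I. f X i = \<tau> i"
  then have "f X = \<tau>" using f_mem[OF X] top_mem by (intro PiE_ext) auto
  then show "X = carrier G" using gf[OF X] gf[OF open_subgroup_carrier] unfolding \<tau>_def by metis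
qed (simp add: \<tau>_def)

lemma A_mem: "i \<in> I \<Longrightarrow> open_subgroup N \<Longrightarrow> (f N)(i := \<tau> i) \<in> \<Lambda>"
  by (simp add: upd_mem f_mem top_coord)

lemma B_mem: "i \<in> I \<Longrightarrow> open_subgroup N \<Longrightarrow> \<tau>(i := f N i) \<in> \<Lambda>"
  by (simp add: upd_mem f_coord top_mem)

lemma open_subgroup_A: "i \<in> I \<Longrightarrow> open_subgroup N \<Longrightarrow> open_subgroup (A i N)"
  unfolding A_def by (rule open_subgroup_g[OF A_mem])

lemma open_subgroup_B: "i \<in> I \<Longrightarrow> open_subgroup N \<Longrightarrow> open_subgroup (B i N)"
  unfolding B_def by (rule open_subgroup_g[OF B_mem])

text \<open>This and the next three lemmas turn inclusions into coordinate conditions. A coordinate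
  raised to the top imposes nothing on a smaller subgroup and forces the top value on a larger
  one.\<close>

lemma subset_A_iff:
  assumes "i \<in> I" "open_subgroup N" "open_subgroup K"
  shows "K \<subseteq> A i N \<longleftrightarrow> (\<forall>j\<in>I - {i}. f K j \<sqsubseteq>\<^bsub>L j\<^esub> f N j)"
  unfolding A_def subset_g_iff[OF assms(3) A_mem[OF assms(1,2)]]
  using assms(1) le_top[OF assms(1) f_coord[OF assms(3,1)]] by auto

lemma subset_B_iff:
  assumes "i \<in> I" "open_subgroup N" "open_subgroup K"
  shows "K \<subseteq> B i N \<longleftrightarrow> f K i \<sqsubseteq>\<^bsub>L i\<^esub> f N i"
  unfolding B_def subset_g_iff[OF assms(3) B_mem[OF assms(1,2)]]
  using assms(1) le_top f_coord[OF assms(3)] by auto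

lemma A_subset_iff:
  assumes "i \<in> I" "open_subgroup N" "open_subgroup K"
  shows "A i N \<subseteq> K \<longleftrightarrow> f K i = \<tau> i \<and> (\<forall>j\<in>I - {i}. f N j \<sqsubseteq>\<^bsub>L j\<^esub> f K j)"
proof -
  have "\<tau> i \<sqsubseteq>\<^bsub>L i\<^esub> f K i \<longleftrightarrow> f K i = \<tau> i"
    using top_le_iff[OF assms(1) f_coord[OF assms(3,1)]] .
  then show ?thesis
    unfolding A_def g_subset_iff[OF A_mem[OF assms(1,2)] assms(3)] using assms(1) by auto
qed

lemma B_subset_iff:
  assumes "i \<in> I" "open_subgroup N" "open_subgroup K"
  shows "B i N \<subseteq> K \<longleftrightarrow> f N i \<sqsubseteq>\<^bsub>L i\<^esub> f K i \<and> (\<forall>j\<in>I - {i}. f K j = \<tau> j)"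
proof -
  have "\<tau> j \<sqsubseteq>\<^bsub>L j\<^esub> f K j \<longleftrightarrow> f K j = \<tau> j" if "j \<in> I" for j
    using top_le_iff[OF that f_coord[OF assms(3) that]] .
  then show ?thesis
    unfolding B_def g_subset_iff[OF B_mem[OF assms(1,2)] assms(3)] using assms(1) by auto
qed

lemma subset_A: "i \<in> I \<Longrightarrow> open_subgroup N \<Longrightarrow> N \<subseteq> A i N"
  by (simp add: subset_A_iff le_refl f_coord)

lemma subset_B: "i \<in> I \<Longrightarrow> open_subgroup N \<Longrightarrow> N \<subseteq> B i N"
  by (simp add: subset_B_iff le_refl f_coord)

lemma A_mono:
  assumes "i \<in> I" "open_subgroup M" "open_subgroup N" "M \<subseteq> N" shows "A i M \<subseteq> A i N"
proof -
  have oA: "open_subgroup (A i N)" using assms by (simp add: open_subgroup_A)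
  have "M \<subseteq> A i N" using assms subset_A by blast
  then have "\<forall>j\<in>I. f M j \<sqsubseteq>\<^bsub>L j\<^esub> f (A i N) j" using subset_iff_f[OF assms(2) oA] by blast
  moreover have "f (A i N) i = \<tau> i" using A_subset_iff[OF assms(1,3) oA] by blast
  ultimately show ?thesis using A_subset_iff[OF assms(1,2) oA] by blast
qed

lemma B_mono:
  assumes "i \<in> I" "open_subgroup M" "open_subgroup N" "M \<subseteq> N" shows "B i M \<subseteq> B i N"
proof -
  have oB: "open_subgroup (B i N)" using assms by (simp add: open_subgroup_B)
  have "M \<subseteq> B i N" using assms subset_B by blast
  then have "\<forall>j\<in>I. f M j \<sqsubseteq>\<^bsub>L j\<^esub> f (B i N) j" using subset_iff_f[OF assms(2) oB] by blast
  moreover have "\<forall>j\<in>I - {i}. f (B i N) j = \<tau> j" using B_subset_iff[OF assms(1,3) oB] by blast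
  ultimately show ?thesis using B_subset_iff[OF assms(1,2) oB] assms(1) by blast
qed

text \<open>Raising the coordinate \<open>j\<close> leaves the coordinate \<open>i\<close> of
  \<open>N\<close> unchanged, and this is the only one that \<open>B i N\<close> restricts. In the
  limit it gives \<open>E_subset_C\<close>.\<close>

lemma A_subset_B: "i \<in> I \<Longrightarrow> j \<in> I \<Longrightarrow> i \<noteq> j \<Longrightarrow> open_subgroup N \<Longrightarrow> A j N \<subseteq> B i N"
  using subset_A_iff[of j N "A j N"] open_subgroup_A[of j N] subset_B_iff[of i N "A j N"] by blast

text \<open>This is where the product structure of the lattice is felt: replacing the coordinate
  \<open>i\<close> of \<open>N\<close> by that of \<open>D\<close>, and replacing the coordinate
  \<open>i\<close> of \<open>D\<close> by that of \<open>N\<close>, gives open subgroups inside the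
  two intersections, and together they account for all coordinates of \<open>D\<close>.\<close>

lemma subset_if_Int_A_B:
  assumes i: "i \<in> I" and N: "open_subgroup N" and D: "open_subgroup D" "N \<subseteq> D" "D \<inter> A i N \<subseteq> N" "D \<inter> B i N \<subseteq> N"
  shows "D \<subseteq> N"
proof -
  have c: "f D j \<in> carrier (L j)" "f N j \<in> carrier (L j)" if "j \<in> I" for j
    using that f_coord D(1) N by auto
  have le: "f N j \<sqsubseteq>\<^bsub>L j\<^esub> f D j" if "j \<in> I" for j using D(2) subset_iff_f[OF N D(1)] that by blast
  let ?a = "(f N)(i := f D i)" and ?b = "(f D)(i := f N i)"
  have m: "?a \<in> \<Lambda>" "?b \<in> \<Lambda>" using i N D f_mem c by (simp_all add: upd_mem)
  have "g ?a \<subseteq> D" "g ?b \<subseteq> D"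
    using g_subset_iff[OF m(1) D(1)] g_subset_iff[OF m(2) D(1)] le c le_refl i by auto
  moreover have "g ?a \<subseteq> A i N" "g ?b \<subseteq> B i N"
    using subset_A_iff[OF i N open_subgroup_g[OF m(1)]] subset_B_iff[OF i N open_subgroup_g[OF m(2)]] f_g[OF m(1)] f_g[OF m(2)]
      c le_refl i by auto
  ultimately have "g ?a \<subseteq> N" "g ?b \<subseteq> N" using D by blast+
  then have "\<forall>j\<in>I. f D j \<sqsubseteq>\<^bsub>L j\<^esub> f N j"
    using g_subset_iff[OF m(1) N] g_subset_iff[OF m(2) N] by (metis fun_upd_apply)
  then show ?thesis using subset_iff_f[OF D(1) N] by blast
qed

lemma A_Int_B: "i \<in> I \<Longrightarrow> open_subgroup N \<Longrightarrow> A i N \<inter> B i N \<subseteq> N"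
proof -
  assume i: "i \<in> I" and N: "open_subgroup N"
  have o: "open_subgroup (A i N \<inter> B i N)" using i N open_subgroup_A open_subgroup_B open_subgroup_Int by blast
  have "f (A i N \<inter> B i N) j \<sqsubseteq>\<^bsub>L j\<^esub> f N j" if "j \<in> I" for j
    using subset_A_iff[OF i N o] subset_B_iff[OF i N o] that by (cases "j = i") auto
  then show ?thesis using subset_iff_f[OF o N] by blast
qed

lemma A_B_generate: "\<lbrakk>i \<in> I; open_subgroup N; open_subgroup K; A i N \<subseteq> K; B i N \<subseteq> K\<rbrakk> \<Longrightarrow> K = carrier G"
  using A_subset_iff[of i N K] B_subset_iff[of i N K] eq_carrier_iff[of K] by auto

text \<open>For leastness, let \<open>X\<close> contain \<open>N\<close> and generate
  \<open>G\<close> together with \<open>B i N\<close>. Then \<open>B i X\<close> contains both and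
  equals \<open>G\<close>, which forces the coordinate \<open>i\<close> of \<open>X\<close> to be
  the top one.\<close>

lemma A_normal:
  assumes i: "i \<in> I" and N: "open_normal N"
  shows "A i N \<lhd> G"
proof (rule normal_if_least_supplement[where B = "B i N" and N = N])
  have oN: "open_subgroup N" using N by (rule open_normal_imp_open_subgroup)
  show "subgroup (A i N) G" "openin T (A i N)" "subgroup (B i N) G"
    using open_subgroup_A[OF i oN] open_subgroup_B[OF i oN] by (auto simp: open_subgroup_def)
  show "N \<lhd> G" using N by (simp add: open_normal_def)
  show "N \<subseteq> A i N" using subset_A[OF i oN] .
  show "K = carrier G" if "subgroup K G" "openin T K" "A i N \<subseteq> K" "B i N \<subseteq> K" for K
    using A_B_generate[OF i oN _ that(3,4)] that(1,2) by (simp add: open_subgroup_def)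
  fix X assume X: "subgroup X G" "openin T X" "N \<subseteq> X"
    and s: "\<And>K. \<lbrakk>subgroup K G; openin T K; X \<subseteq> K; B i N \<subseteq> K\<rbrakk> \<Longrightarrow> K = carrier G"
  have oX: "open_subgroup X" using X by (simp add: open_subgroup_def)
  have le: "f N j \<sqsubseteq>\<^bsub>L j\<^esub> f X j" if "j \<in> I" for j using X(3) subset_iff_f[OF oN oX] that by blast
  have "B i X = carrier G"
  proof (rule s)
    show "subgroup (B i X) G" "openin T (B i X)" using open_subgroup_B[OF i oX] by (auto simp: open_subgroup_def)
    show "X \<subseteq> B i X" by (rule subset_B[OF i oX])
    show "B i N \<subseteq> B i X" by (rule B_mono[OF i oN oX X(3)])
  qed
  then have "f X i = \<tau> i"
    using f_g[OF B_mem[OF i oX]] unfolding B_def \<tau>_def by (metis fun_upd_same)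
  then show "A i N \<subseteq> X" using A_subset_iff[OF i oN oX] le by blast
qed

text \<open>The mirror image of \<open>A_normal\<close>: now \<open>A i X\<close> equals
  \<open>G\<close>, so every coordinate of \<open>X\<close> other than \<open>i\<close> is the top
  one.\<close>

lemma B_normal:
  assumes i: "i \<in> I" and N: "open_normal N"
  shows "B i N \<lhd> G"
proof (rule normal_if_least_supplement[where B = "A i N" and N = N])
  have oN: "open_subgroup N" using N by (rule open_normal_imp_open_subgroup)
  show "subgroup (B i N) G" "openin T (B i N)" "subgroup (A i N) G"
    using open_subgroup_A[OF i oN] open_subgroup_B[OF i oN] by (auto simp: open_subgroup_def)
  show "N \<lhd> G" using N by (simp add: open_normal_def)
  show "N \<subseteq> B i N" using subset_B[OF i oN] .
  show "K = carrier G" if "subgroup K G" "openin T K" "B i N \<subseteq> K" "A i N \<subseteq> K" for K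
    using A_B_generate[OF i oN _ that(4,3)] that(1,2) by (simp add: open_subgroup_def)
  fix X assume X: "subgroup X G" "openin T X" "N \<subseteq> X"
    and s: "\<And>K. \<lbrakk>subgroup K G; openin T K; X \<subseteq> K; A i N \<subseteq> K\<rbrakk> \<Longrightarrow> K = carrier G"
  have oX: "open_subgroup X" using X by (simp add: open_subgroup_def)
  have le: "f N j \<sqsubseteq>\<^bsub>L j\<^esub> f X j" if "j \<in> I" for j using X(3) subset_iff_f[OF oN oX] that by blast
  have "A i X = carrier G"
  proof (rule s)
    show "subgroup (A i X) G" "openin T (A i X)" using open_subgroup_A[OF i oX] by (auto simp: open_subgroup_def)
    show "X \<subseteq> A i X" by (rule subset_A[OF i oX])
    show "A i N \<subseteq> A i X" by (rule A_mono[OF i oN oX X(3)])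
  qed
  then have "f X j = \<tau> j" if "j \<noteq> i" for j
    using f_g[OF A_mem[OF i oX]] that unfolding A_def \<tau>_def by (metis fun_upd_other)
  then show "B i N \<subseteq> X" using B_subset_iff[OF i oN oX] le i by blast
qed

section \<open>The closed normal factors and their complements\<close>

definition "E i = \<Inter> (A i ` Collect open_normal)"

definition "C i = \<Inter> (B i ` Collect open_normal)"

lemma open_normal_carrier: "open_normal (carrier G)"
  by (simp add: open_normal_def normal_carrier openin_carrier)

lemma open_normal_avoiding: "x \<in> carrier G \<Longrightarrow> x \<noteq> \<one> \<Longrightarrow> \<exists>N. open_normal N \<and> x \<notin> N"
  unfolding open_normal_def using open_normal_subgroup_avoiding by metis

text \<open>The family is nonempty since \<open>G\<close> itself is open and normal; otherwise the
  intersection would be \<open>UNIV\<close>.\<close>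

lemma normal_Inter_image:
  assumes "\<And>N. open_normal N \<Longrightarrow> S N \<lhd> G \<and> openin T (S N)"
  shows "\<Inter> (S ` Collect open_normal) \<lhd> G" "closedin T (\<Inter> (S ` Collect open_normal))"
proof -
  have s: "subgroup (S N) G" "openin T (S N)" "S N \<lhd> G" if "open_normal N" for N
    using assms[OF that] normal_imp_subgroup by auto
  have ne: "S ` Collect open_normal \<noteq> {}" using open_normal_carrier by blast
  show "closedin T (\<Inter> (S ` Collect open_normal))"
    by (rule closedin_Inter[OF ne]) (use s closedin_open_subgroup in auto)
  have "subgroup (\<Inter> (S ` Collect open_normal)) G"
    by (rule subgroups_Inter[OF _ ne]) (use s in auto)
  then show "\<Inter> (S ` Collect open_normal) \<lhd> G"
    by (rule normal_invI) (use normal_invE(2)[OF s(3)] in blast)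
qed

lemma A_props: "i \<in> I \<Longrightarrow> open_normal N \<Longrightarrow> A i N \<lhd> G \<and> openin T (A i N)"
  using A_normal open_subgroup_A[OF _ open_normal_imp_open_subgroup] by (simp add: open_subgroup_def)

lemma B_props: "i \<in> I \<Longrightarrow> open_normal N \<Longrightarrow> B i N \<lhd> G \<and> openin T (B i N)"
  using B_normal open_subgroup_B[OF _ open_normal_imp_open_subgroup] by (simp add: open_subgroup_def)

lemma E_normal: "i \<in> I \<Longrightarrow> E i \<lhd> G"
  unfolding E_def by (rule normal_Inter_image(1)[OF A_props])

lemma E_closed: "i \<in> I \<Longrightarrow> closedin T (E i)"
  unfolding E_def by (rule normal_Inter_image(2)[OF A_props])

lemma C_normal: "i \<in> I \<Longrightarrow> C i \<lhd> G"
  unfolding C_def by (rule normal_Inter_image(1)[OF B_props])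

lemma C_closed: "i \<in> I \<Longrightarrow> closedin T (C i)"
  unfolding C_def by (rule normal_Inter_image(2)[OF B_props])

lemma E_subset: "i \<in> I \<Longrightarrow> E i \<subseteq> carrier G"
  using E_normal normal_imp_subgroup subgroup.subset by metis

lemma E_Int_C:
  assumes i: "i \<in> I" shows "E i \<inter> C i \<subseteq> {\<one>}"
proof
  fix x assume x: "x \<in> E i \<inter> C i"
  then have xG: "x \<in> carrier G" using E_subset[OF i] by blast
  show "x \<in> {\<one>}"
  proof (rule ccontr)
    assume "x \<notin> {\<one>}"
    then obtain N where N: "open_normal N" "x \<notin> N" using open_normal_avoiding[OF xG] by blast
    then show False using x A_Int_B[OF i open_normal_imp_open_subgroup[OF N(1)]] unfolding E_def C_def by blast
  qed
qed

text \<open>For each \<open>N\<close> the admissible first factors of \<open>x\<close> with respect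
  to \<open>A i N\<close> and \<open>B i N\<close> form a closed nonempty set \<open>S N\<close>
  that decreases with \<open>N\<close>; a common element is the wanted \<open>y\<close>.\<close>

lemma E_mult_C:
  assumes i: "i \<in> I" and x: "x \<in> carrier G" shows "\<exists>y\<in>E i. inv y \<otimes> x \<in> C i"
proof -
  have ct: "continuous_map T T (\<lambda>y. inv y \<otimes> x)"
    using x by (intro continuous_map_mult continuous_inv) (simp add: topspace_eq)
  define S where "S N = A i N \<inter> {y \<in> topspace T. inv y \<otimes> x \<in> B i N}" for N
  obtain y where y: "y \<in> carrier G" "\<And>N. N \<lhd> G \<Longrightarrow> openin T N \<Longrightarrow> y \<in> S N"
  proof (rule directed_closed_inter_nonempty[of S])
    fix N assume "N \<lhd> G" "openin T N"
    then have N: "open_normal N" by (simp add: open_normal_def)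
    have AB: "subgroup (A i N) G" "openin T (A i N)" "A i N \<lhd> G" "subgroup (B i N) G" "openin T (B i N)"
      using A_props[OF i N] B_props[OF i N] normal_imp_subgroup by auto
    have "closedin T (S N)"
      unfolding S_def
      by (intro closedin_Int closedin_continuous_map_preimage[OF ct] closedin_open_subgroup AB)
    moreover have "S N \<noteq> {}"
    proof -
      \<comment> \<open>The product set is a subgroup because \<open>A i N\<close> is normal, and
        open because it contains \<open>A i N\<close>, so it corresponds to a lattice element and
        must be everything.\<close>
      have K: "subgroup (A i N <#> B i N) G" by (rule mult_norm_subgroup[OF AB(3,4)])
      have ABG: "A i N \<subseteq> carrier G" "B i N \<subseteq> carrier G" using AB subgroup.subset by blast+
      have sub: "A i N \<subseteq> A i N <#> B i N" "B i N \<subseteq> A i N <#> B i N"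
        using subset_set_mult[OF AB(1,4)] .
      have "open_subgroup (A i N <#> B i N)" using open_subgroup_mono[OF open_subgroup_A[OF i open_normal_imp_open_subgroup[OF N]] K sub(1)] .
      then have "A i N <#> B i N = carrier G" using A_B_generate[OF i open_normal_imp_open_subgroup[OF N]] sub by blast
      then obtain a b where ab: "a \<in> A i N" "b \<in> B i N" "x = a \<otimes> b"
        using x unfolding set_mult_def by blast
      then have "inv a \<otimes> x = b" using ABG by (auto simp: m_assoc[symmetric] subset_iff)
      then have "a \<in> S N" unfolding S_def using ab ABG by (auto simp: topspace_eq)
      then show ?thesis by blast
    qed
    ultimately show "closedin T (S N) \<and> S N \<noteq> {}" by simp
  next
    fix M N assume MN: "M \<lhd> G" "openin T M" "N \<lhd> G" "openin T N" "M \<subseteq> N"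
    then have "open_subgroup M" "open_subgroup N" by (simp_all add: open_subgroup_def normal_imp_subgroup)
    then show "S M \<subseteq> S N" unfolding S_def using A_mono[OF i] B_mono[OF i] MN(5) by blast
  qed blast
  have "y \<in> E i" "inv y \<otimes> x \<in> C i"
    using y(2) unfolding E_def C_def S_def open_normal_def by auto
  then show ?thesis by blast
qed

lemma E_subset_C: "i \<in> I \<Longrightarrow> j \<in> I \<Longrightarrow> i \<noteq> j \<Longrightarrow> E i \<subseteq> C j"
  unfolding E_def C_def using A_subset_B open_normal_imp_open_subgroup by blast

text \<open>Only open subgroups have coordinates, so \<open>x\<close> is replaced by the open
  subgroup it generates together with \<open>N\<close>. This lies in every \<open>B i N\<close>,
  hence each of its coordinates is below that of \<open>N\<close>.\<close>

lemma Inter_C: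
  assumes x: "x \<in> carrier G" and xC: "\<And>i. i \<in> I \<Longrightarrow> x \<in> C i"
  shows "x = \<one>"
proof (rule ccontr)
  assume "x \<noteq> \<one>"
  then obtain N where N: "open_normal N" "x \<notin> N" using open_normal_avoiding x by blast
  let ?K = "N <#> generate G {x}"
  have oN: "open_subgroup N" by (rule open_normal_imp_open_subgroup[OF N(1)])
  have gx: "subgroup (generate G {x}) G" using x by (simp add: generate_is_subgroup)
  have K: "subgroup ?K G" using N(1) mult_norm_subgroup[OF _ gx] by (simp add: open_normal_def)
  have NK: "N \<subseteq> ?K" and xK: "x \<in> ?K"
    using subset_set_mult[OF _ gx, of N] oN generate.incl[of x "{x}" G] unfolding open_subgroup_def by blast+
  have oK: "open_subgroup ?K" by (rule open_subgroup_mono[OF oN K NK])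
  have "f ?K i \<sqsubseteq>\<^bsub>L i\<^esub> f N i" if i: "i \<in> I" for i
  proof -
    have sB: "subgroup (B i N) G" using open_subgroup_B[OF i oN] by (simp add: open_subgroup_def)
    have "x \<in> B i N" using xC[OF i] N(1) unfolding C_def by blast
    then have "generate G {x} \<subseteq> B i N" using generate_subgroup_incl[OF _ sB] by blast
    then have "?K \<subseteq> B i N"
      using subset_B[OF i oN] subgroup.m_closed[OF sB] unfolding set_mult_def by blast
    then show ?thesis using subset_B_iff[OF i oN oK] by blast
  qed
  then have "?K \<subseteq> N" using subset_iff_f[OF oK oN] by blast
  then show False using xK N(2) by blast
qed

lemma iso_product:
  "topological_group_iso G T (product_group I (\<lambda>i. G\<lparr>carrier := E i\<rparr>))
    (product_topology (\<lambda>i. subtopology T (E i)) I)"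
  by (rule topological_group_iso_product[OF finite_index E_normal E_closed C_normal C_closed E_Int_C
        E_mult_C E_subset_C Inter_C])

text \<open>An open normal \<open>N\<close> inside the subgroup has coordinate \<open>i\<close>
  below \<open>u\<close>, so \<open>B i N\<close> is still inside. With \<open>open_above_C\<close>
  this identifies the open subgroups above \<open>C i\<close> with the elements of
  \<open>L i\<close>.\<close>

lemma C_subset_upd:
  assumes i: "i \<in> I" and u: "u \<in> carrier (L i)"
  shows "C i \<subseteq> g (\<tau>(i := u))"
proof -
  have m: "\<tau>(i := u) \<in> \<Lambda>" using upd_mem[OF top_mem i u] .
  then have o: "open_subgroup (g (\<tau>(i := u)))" by (rule open_subgroup_g)
  then have "openin T (g (\<tau>(i := u)))" "\<one> \<in> g (\<tau>(i := u))"
    by (auto simp: open_subgroup_def subgroup.one_closed)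
  then obtain N where "N \<lhd> G" "openin T N" "N \<subseteq> g (\<tau>(i := u))"
    by (rule open_normal_subgroup_below)
  then have N: "open_normal N" "open_subgroup N" "N \<subseteq> g (\<tau>(i := u))" using open_normal_imp_open_subgroup by (auto simp: open_normal_def)
  have "f N i \<sqsubseteq>\<^bsub>L i\<^esub> u" using N(3) subset_g_iff[OF N(2) m] i by auto
  then have "B i N \<subseteq> g (\<tau>(i := u))" unfolding B_subset_iff[OF i N(2) o] f_g[OF m] by simp
  then show ?thesis using N(1) unfolding C_def by blast
qed

text \<open>By compactness \<open>Q\<close> already contains some \<open>B i N\<close>; otherwise
  the sets \<open>B i N - Q\<close> would have a common point, in \<open>C i\<close> but not in
  \<open>Q\<close>. Containing \<open>B i N\<close> forces the top value at all coordinates but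
  \<open>i\<close>.\<close>

lemma open_above_C:
  assumes i: "i \<in> I" and Q: "open_subgroup Q" "C i \<subseteq> Q"
  shows "Q = g (\<tau>(i := f Q i))"
proof -
  have "\<exists>N. open_normal N \<and> B i N \<subseteq> Q"
  proof (rule ccontr)
    assume no: "\<not> (\<exists>N. open_normal N \<and> B i N \<subseteq> Q)"
    obtain x where x: "\<And>N. N \<lhd> G \<Longrightarrow> openin T N \<Longrightarrow> x \<in> B i N - Q"
    proof (rule directed_closed_inter_nonempty[of "\<lambda>N. B i N - Q"])
      fix N assume "N \<lhd> G" "openin T N"
      then have N: "open_normal N" by (simp add: open_normal_def)
      then have "closedin T (B i N)"
        using open_subgroup_B[OF i open_normal_imp_open_subgroup] closedin_open_subgroup by (simp add: open_subgroup_def)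
      then show "closedin T (B i N - Q) \<and> B i N - Q \<noteq> {}"
        using no N Q(1) by (auto simp: open_subgroup_def closedin_diff)
    next
      fix M N assume MN: "M \<lhd> G" "openin T M" "N \<lhd> G" "openin T N" "M \<subseteq> N"
      then have "open_subgroup M" "open_subgroup N" by (simp_all add: open_subgroup_def normal_imp_subgroup)
      then show "B i M - Q \<subseteq> B i N - Q" using B_mono[OF i] MN(5) by blast
    qed blast
    then have "x \<in> C i" unfolding C_def open_normal_def by blast
    then show False using x[OF normal_carrier openin_carrier] Q(2) by blast
  qed
  then obtain N where N: "open_normal N" "B i N \<subseteq> Q" by blast
  then have "\<forall>j\<in>I - {i}. f Q j = \<tau> j" using B_subset_iff[OF i open_normal_imp_open_subgroup[OF N(1)] Q(1)] by blast
  then have "f Q = \<tau>(i := f Q i)"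
    by (intro PiE_ext[OF f_mem[OF Q(1)] B_mem[OF i Q(1)]]) auto
  then show ?thesis using gf[OF Q(1)] by simp
qed

text \<open>Elements of \<open>L i\<close> correspond to the open subgroups of \<open>G\<close>
  above \<open>C i\<close>, and intersecting those with the complement \<open>E i\<close> of
  \<open>C i\<close> gives the open subgroups of \<open>E i\<close>.\<close>

lemma order_iso_factor:
  assumes i: "i \<in> I"
  shows "order_iso (open_subgroup_lattice (G\<lparr>carrier := E i\<rparr>) (subtopology T (E i))) (L i)"
proof (rule order_iso_sym)
  have sE: "subgroup (E i) G" and sC: "subgroup (C i) G"
    using E_normal[OF i] C_normal[OF i] by (simp_all add: normal_imp_subgroup)
  let ?H = "G\<lparr>carrier := E i\<rparr>" and ?U = "subtopology T (E i)"
  define \<psi> where "\<psi> u = g (\<tau>(i := u)) \<inter> E i" for u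
  have o: "open_subgroup (g (\<tau>(i := u)))" if "u \<in> carrier (L i)" for u
    using open_subgroup_g[OF upd_mem[OF top_mem i that]] .
  obtain e where e: "e \<in> hom G ?H" "continuous_map T ?U e"
    "\<And>x. x \<in> E i \<Longrightarrow> e x = x" "\<And>x. x \<in> carrier G \<Longrightarrow> inv (e x) \<otimes> x \<in> C i" "\<And>x. x \<in> C i \<Longrightarrow> e x = \<one>"
  proof (rule projection_of_decomposition[OF E_normal[OF i] E_closed[OF i] C_normal[OF i] C_closed[OF i]
        E_Int_C[OF i]])
    show "\<exists>y\<in>E i. inv y \<otimes> x \<in> C i" if "x \<in> carrier G" for x
      by (rule E_mult_C[OF i that])
  qed (rule that)
  have eE: "e x \<in> E i" if "x \<in> carrier G" for x using e(1) that by (auto simp: hom_def)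
  have eG: "e x \<in> carrier G" if "x \<in> carrier G" for x using eE[OF that] E_subset[OF i] by blast
  have split: "x = e x \<otimes> (inv (e x) \<otimes> x)" if "x \<in> carrier G" for x
    using that eG[OF that] by (simp add: m_assoc[symmetric])
  have \<psi>_closed: "subgroup (\<psi> u) ?H \<and> openin ?U (\<psi> u)" if u: "u \<in> carrier (L i)" for u
  proof
    have "subgroup (g (\<tau>(i := u)) \<inter> E i) G" using o[OF u] sE by (simp add: open_subgroup_def subgroups_Inter_pair)
    then show "subgroup (\<psi> u) ?H" unfolding \<psi>_def using subgroup_incl[OF _ sE] by simp
    show "openin ?U (\<psi> u)" unfolding \<psi>_def using o[OF u] by (auto simp: open_subgroup_def openin_subtopology)
  qed
  have le: "\<psi> u \<subseteq> \<psi> v \<longleftrightarrow> u \<sqsubseteq>\<^bsub>L i\<^esub> v" if u: "u \<in> carrier (L i)" and v: "v \<in> carrier (L i)" for u v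
  proof -
    have mu: "\<tau>(i := u) \<in> \<Lambda>" and mv: "\<tau>(i := v) \<in> \<Lambda>" using upd_mem[OF top_mem i] u v by auto
    have "g (\<tau>(i := u)) \<subseteq> g (\<tau>(i := v)) \<longleftrightarrow> u \<sqsubseteq>\<^bsub>L i\<^esub> v"
      using g_subset_iff[OF mu o[OF v]] f_g[OF mv] i le_refl top_coord by auto
    \<comment> \<open>Both subgroups contain \<open>C i\<close>, so an element belongs to one of
      them as soon as its \<open>E i\<close>-component does.\<close>
    moreover have "g (\<tau>(i := u)) \<subseteq> g (\<tau>(i := v))" if *: "\<psi> u \<subseteq> \<psi> v"
    proof
      fix x assume x: "x \<in> g (\<tau>(i := u))"
      have su: "subgroup (g (\<tau>(i := u))) G" and sv: "subgroup (g (\<tau>(i := v))) G"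
        using o u v by (auto simp: open_subgroup_def)
      have xG: "x \<in> carrier G" using x su subgroup.subset by blast
      have c: "inv (e x) \<otimes> x \<in> C i" using e(4)[OF xG] .
      then have "x \<otimes> inv (inv (e x) \<otimes> x) \<in> g (\<tau>(i := u))"
        using x C_subset_upd[OF i u] su by (meson subgroup.m_closed subgroup.m_inv_closed subsetD)
      moreover have "x \<otimes> inv (inv (e x) \<otimes> x) = e x"
        using xG eG[OF xG] by (simp add: inv_mult_group m_assoc[symmetric])
      ultimately have "e x \<in> g (\<tau>(i := v))" using * eE[OF xG] unfolding \<psi>_def by auto
      then have "e x \<otimes> (inv (e x) \<otimes> x) \<in> g (\<tau>(i := v))"
        using c C_subset_upd[OF i v] sv by (meson subgroup.m_closed subsetD)
      then show "x \<in> g (\<tau>(i := v))" using split[OF xG] by simp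
    qed
    ultimately show ?thesis unfolding \<psi>_def by blast
  qed
  have surj: "\<exists>u\<in>carrier (L i). \<psi> u = X" if X: "subgroup X ?H" "openin ?U X" for X
  proof -
    have XE: "X \<subseteq> E i" using subgroup.subset[OF X(1)] by simp
    have sX: "subgroup X G" using incl_subgroup[OF sE X(1)] .
    \<comment> \<open>The preimage of \<open>X\<close> under the projection contains the kernel
      \<open>C i\<close>, so its coordinate \<open>i\<close> is the element of \<open>L i\<close>
      that \<open>\<psi>\<close> sends to \<open>X\<close>.\<close>
    let ?Q = "{x \<in> carrier G. e x \<in> X}"
    interpret eh: group_hom G ?H e
      by (intro group_hom.intro group_hom_axioms.intro group_axioms subgroup_imp_group[OF sE] e(1))
    have "openin T ?Q"
      using openin_continuous_map_preimage[OF e(2) X(2)] by (simp add: topspace_eq)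
    moreover have "subgroup ?Q G"
    proof (rule subgroupI)
      have "e \<one> \<in> X" using eh.hom_one subgroup.one_closed[OF sX] by simp
      then show "?Q \<noteq> {}" by blast
      fix x assume x: "x \<in> ?Q"
      then show "inv x \<in> ?Q" using eh.hom_inv[of x] subgroup.m_inv_closed[OF X(1), of "e x"] by simp
      fix y assume "y \<in> ?Q"
      then show "x \<otimes> y \<in> ?Q" using x eh.hom_mult[of x y] subgroup.m_closed[OF sX] by simp
    qed auto
    ultimately have oQ: "open_subgroup ?Q" by (simp add: open_subgroup_def)
    have "C i \<subseteq> ?Q"
      using e(5) subgroup.one_closed[OF sX] subgroup.subset[OF sC] by auto
    then have "?Q = g (\<tau>(i := f ?Q i))" by (rule open_above_C[OF i oQ])
    then have "\<psi> (f ?Q i) = ?Q \<inter> E i" unfolding \<psi>_def by simp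
    also have "\<dots> = X" using XE e(3) E_subset[OF i] by auto
    finally show ?thesis using f_coord[OF oQ i] by blast
  qed
  have inj: "inj_on \<psi> (carrier (L i))"
    using le le_antisym[OF i] by (intro inj_onI) (metis order_refl)
  have "bij_betw \<psi> (carrier (L i)) {X. subgroup X ?H \<and> openin ?U X}"
    unfolding bij_betw_def using inj \<psi>_closed surj by blast
  then show "order_iso (L i) (open_subgroup_lattice ?H ?U)"
    unfolding order_iso_def open_subgroup_lattice_def using le by (intro exI[of _ \<psi>]) simp
qed

lemma pi_star_disjoint:
  assumes i: "i \<in> I" and j: "j \<in> I" and ij: "i \<noteq> j"
  shows "pi_star (G\<lparr>carrier := E i\<rparr>) (subtopology T (E i)) \<inter>
    pi_star (G\<lparr>carrier := E j\<rparr>) (subtopology T (E j)) = {}"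
proof (rule ccontr)
  have sE: "subgroup (E i) G" "subgroup (E j) G" using E_normal i j by (simp_all add: normal_imp_subgroup)
  assume "\<not> ?thesis"
  then obtain p where p: "p \<in> pi_star (G\<lparr>carrier := E i\<rparr>) (subtopology T (E i))"
      "p \<in> pi_star (G\<lparr>carrier := E j\<rparr>) (subtopology T (E j))" by blast
  then have prime: "prime p" by (simp add: pi_star_def)
  obtain x where x: "x \<in> E i" "x \<noteq> \<one>" "\<And>N. N \<lhd> G \<Longrightarrow> openin T N \<Longrightarrow> \<exists>k. x [^] (p ^ k) \<in> N"
    by (rule pi_star_closed_subgroupE[OF sE(1) E_closed[OF i] p(1)]) blast
  obtain y where y: "y \<in> E j" "y \<noteq> \<one>" "\<And>N. N \<lhd> G \<Longrightarrow> openin T N \<Longrightarrow> \<exists>k. y [^] (p ^ k) \<in> N"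
    by (rule pi_star_closed_subgroupE[OF sE(2) E_closed[OF j] p(2)]) blast
  have xyG: "x \<in> carrier G" "y \<in> carrier G" using x y E_subset i j by auto
  obtain M where M: "open_normal M" "x \<notin> M" using open_normal_avoiding[OF xyG(1) x(2)] by blast
  obtain M' where M': "open_normal M'" "y \<notin> M'" using open_normal_avoiding[OF xyG(2) y(2)] by blast
  \<comment> \<open>A single \<open>N\<close> must miss both elements, so that both have nontrivial
    p-power order modulo it.\<close>
  define N where "N = M \<inter> M'"
  have N: "open_normal N" "x \<notin> N" "y \<notin> N"
    using M M' unfolding N_def open_normal_def by (auto simp: normal_subgroup_intersect openin_Int)
  have oN: "open_subgroup N" by (rule open_normal_imp_open_subgroup[OF N(1)])
  have nN: "N \<lhd> G" "openin T N" using N(1) by (auto simp: open_normal_def)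
  have sN: "subgroup N G" using oN by (simp add: open_subgroup_def)
  obtain k where k: "x [^] (p ^ k) \<notin> N" "(x [^] (p ^ k)) [^] p \<in> N"
    using prime_power_torsion_modulo[OF xyG(1) N(2) x(3)[OF nN]] .
  obtain l where l: "y [^] (p ^ l) \<notin> N" "(y [^] (p ^ l)) [^] p \<in> N"
    using prime_power_torsion_modulo[OF xyG(2) N(3) y(3)[OF nN]] .
  define a where "a = x [^] (p ^ k)"
  define b where "b = y [^] (p ^ l)"
  have aE: "a \<in> E i" unfolding a_def using x(1) sE(1)
    by (metis int_pow_int subgroup_int_pow_closed)
  have bE: "b \<in> E j" unfolding b_def using y(1) sE(2)
    by (metis int_pow_int subgroup_int_pow_closed)
  have abG: "a \<in> carrier G" "b \<in> carrier G" using aE bE E_subset i j by auto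
  \<comment> \<open>Normal subgroups with trivial intersection commute elementwise; this lets the
    p-th power be taken factor by factor.\<close>
  have comm: "a \<otimes> b = b \<otimes> a"
    using E_normal[OF i] E_normal[OF j] E_subset_C[OF j i] ij E_Int_C[OF i] aE bE
    by (intro normal_imp_commuting[of "E i" "E j"]) blast+
  have ab_p: "(a \<otimes> b) [^] p \<in> N"
    using k(2) l(2) pow_mult_distrib[OF comm abG] subgroup.m_closed[OF sN] unfolding a_def b_def by simp
  have sA: "subgroup (A i N) G" and sB: "subgroup (B i N) G"
    using open_subgroup_A[OF i oN] open_subgroup_B[OF i oN] by (auto simp: open_subgroup_def)
  have aA: "a \<in> A i N" using aE N(1) unfolding E_def by blast
  have bB: "b \<in> B i N" using bE E_subset_C[OF j i] ij N(1) unfolding C_def by blast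
  have AB: "A i N \<inter> B i N \<subseteq> N" by (rule A_Int_B[OF i oN])
  have ab_A: "a \<otimes> b \<notin> A i N"
  proof
    assume "a \<otimes> b \<in> A i N"
    then have "inv a \<otimes> (a \<otimes> b) \<in> A i N" using aA sA by (simp add: subgroup.m_closed subgroup.m_inv_closed)
    then have "b \<in> A i N" using abG by (simp add: m_assoc[symmetric])
    then show False using bB AB l(1) unfolding b_def by blast
  qed
  have ab_B: "a \<otimes> b \<notin> B i N"
  proof
    assume "a \<otimes> b \<in> B i N"
    then have "(a \<otimes> b) \<otimes> inv b \<in> B i N" using bB sB by (simp add: subgroup.m_closed subgroup.m_inv_closed)
    then have "a \<in> B i N" using abG by (simp add: m_assoc)
    then show False using aA AB k(1) unfolding a_def by blast
  qed
  \<comment> \<open>Modulo \<open>N\<close> this is the diagonal subgroup of order p. It is not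
    contained in \<open>N\<close>, although its intersections with \<open>A i N\<close> and
    \<open>B i N\<close> are.\<close>
  let ?D = "N <#> generate G {a \<otimes> b}"
  have gen: "subgroup (generate G {a \<otimes> b}) G" using abG by (simp add: generate_is_subgroup)
  have sD: "subgroup ?D G" by (rule mult_norm_subgroup[OF nN(1) gen])
  have ND: "N \<subseteq> ?D" and abD: "a \<otimes> b \<in> ?D"
    using subset_set_mult[OF sN gen] generate.incl[of "a \<otimes> b" "{a \<otimes> b}" G] by blast+
  have oD: "open_subgroup ?D" by (rule open_subgroup_mono[OF oN sD ND])
  have "?D \<inter> A i N \<subseteq> N"
    using cyclic_extension_Int[OF nN(1) sA subset_A[OF i oN] _ ab_A prime ab_p] abG by simp
  moreover have "?D \<inter> B i N \<subseteq> N"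
    using cyclic_extension_Int[OF nN(1) sB subset_B[OF i oN] _ ab_B prime ab_p] abG by simp
  ultimately have "?D \<subseteq> N" by (rule subset_if_Int_A_B[OF i oN oD ND])
  then show False using abD ab_A subset_A[OF i oN] by blast
qed

end

section \<open>The two implications\<close>

lemma product_decomposition_if_order_iso:
  fixes G :: "('a, 'n) monoid_scheme" and L :: "'i \<Rightarrow> ('b, 'm) gorder_scheme"
  assumes G: "profinite_group G T" and I: "finite I"
    and L: "\<And>i. i \<in> I \<Longrightarrow> partial_order (L i)"
    and iso: "order_iso (open_subgroup_lattice G T) (product_lattice I L)"
  obtains E where "\<And>i. i \<in> I \<Longrightarrow> subgroup (E i) G" "\<And>i. i \<in> I \<Longrightarrow> closedin T (E i)"
    "\<And>i. i \<in> I \<Longrightarrow> order_iso (open_subgroup_lattice (G\<lparr>carrier := E i\<rparr>) (subtopology T (E i))) (L i)"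
    "\<And>i j. \<lbrakk>i \<in> I; j \<in> I; i \<noteq> j\<rbrakk> \<Longrightarrow> pi_star (G\<lparr>carrier := E i\<rparr>) (subtopology T (E i)) \<inter>
      pi_star (G\<lparr>carrier := E j\<rparr>) (subtopology T (E j)) = {}"
    "topological_group_iso G T (product_group I (\<lambda>i. G\<lparr>carrier := E i\<rparr>))
      (product_topology (\<lambda>i. subtopology T (E i)) I)"
proof -
  let ?A = "{X. subgroup X G \<and> openin T X}" and ?L = "\<Pi>\<^sub>E i\<in>I. carrier (L i)"
  obtain f where f: "bij_betw f ?A ?L"
      "\<And>X Y. \<lbrakk>X \<in> ?A; Y \<in> ?A\<rbrakk> \<Longrightarrow> (\<forall>i\<in>I. f X i \<sqsubseteq>\<^bsub>L i\<^esub> f Y i) \<longleftrightarrow> X \<subseteq> Y"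
    using iso unfolding order_iso_def open_subgroup_lattice_def product_lattice_def by auto
  let ?g = "inv_into ?A f"
  have g: "?g x \<in> ?A" "f (?g x) = x" if "x \<in> ?L" for x
    using bij_betw_apply[OF bij_betw_inv_into[OF f(1)] that] bij_betw_inv_into_right[OF f(1) that] by auto
  have gf: "?g (f X) = X" "f X \<in> ?L" if "X \<in> ?A" for X
    using bij_betw_inv_into_left[OF f(1) that] bij_betw_apply[OF f(1) that] by auto
  interpret open_subgroup_product G T I L f ?g
    by (intro open_subgroup_product.intro open_subgroup_product_axioms.intro G I L)
      (use g gf f(2) in auto)
  show ?thesis
    by (rule that[of E]) (use E_normal E_closed order_iso_factor pi_star_disjoint iso_product in
        \<open>simp_all add: normal_imp_subgroup\<close>)
qed

lemma product_lattice_iso_if_decomposition: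
  fixes G :: "('a, 'm) monoid_scheme" and L :: "'i \<Rightarrow> ('b, 'n) gorder_scheme"
    and H :: "'i \<Rightarrow> ('c, 'k) monoid_scheme"
  assumes G: "profinite_group G T" and I: "finite I" and L: "\<And>i. i \<in> I \<Longrightarrow> lattice (L i)"
    and H: "\<forall>i\<in>I. profinite_group (H i) (U i) \<and> lattice_iso (open_subgroup_lattice (H i) (U i)) (L i)"
    and disj: "\<forall>i\<in>I. \<forall>j\<in>I. i \<noteq> j \<longrightarrow> pi_star (H i) (U i) \<inter> pi_star (H j) (U j) = {}"
    and iso: "topological_group_iso G T (product_group I H) (product_topology U I)"
  shows "lattice_iso (open_subgroup_lattice G T) (product_lattice I L)"
proof -
  have "order_iso (open_subgroup_lattice (H i) (U i)) (L i)" if "i \<in> I" for i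
    using H that L lattice_iso_iff_order_iso topological_group.lattice_open_subgroups profinite_group.axioms(1)
    by metis
  then have "order_iso (open_subgroup_lattice G T) (product_lattice I L)"
    using H disj by (intro order_iso_if_product_decomposition[OF G I _ _ _ iso]) auto
  then show ?thesis
    using lattice_iso_iff_order_iso lattice_product_lattice[of I L] L
      topological_group.lattice_open_subgroups[OF profinite_group.axioms(1)[OF G]] by blast
qed

text \<open>The type of the factors cannot be quantified inside the formula. The equivalence finds
  the factors over the type of \<open>G\<close>; the second conjunct gives the converse for factors
  over any type \<open>'c\<close>.\<close>

theorem theorem4p4:
  fixes G :: "'a monoid" and T :: "'a topology"
    and I :: "'i set" and L :: "'i \<Rightarrow> 'b gorder"
  assumes "profinite_group G T"
    and "finite I"
    and "\<And>i. i \<in> I \<Longrightarrow> lattice (L i)"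
    and "\<And>i. i \<in> I \<Longrightarrow> \<exists>x\<in>carrier (L i). \<exists>y\<in>carrier (L i). x \<noteq> y"
  shows "(lattice_iso (open_subgroup_lattice G T) (product_lattice I L) \<longleftrightarrow>
      (\<exists>(H :: 'i \<Rightarrow> 'a monoid) (U :: 'i \<Rightarrow> 'a topology).
        (\<forall>i\<in>I. profinite_group (H i) (U i) \<and>
               lattice_iso (open_subgroup_lattice (H i) (U i)) (L i)) \<and>
        (\<forall>i\<in>I. \<forall>j\<in>I. i \<noteq> j \<longrightarrow> pi_star (H i) (U i) \<inter> pi_star (H j) (U j) = {}) \<and>
        topological_group_iso G T (product_group I H) (product_topology U I))) \<and>
    ((\<exists>(H :: 'i \<Rightarrow> 'c monoid) (U :: 'i \<Rightarrow> 'c topology).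
        (\<forall>i\<in>I. profinite_group (H i) (U i) \<and>
               lattice_iso (open_subgroup_lattice (H i) (U i)) (L i)) \<and>
        (\<forall>i\<in>I. \<forall>j\<in>I. i \<noteq> j \<longrightarrow> pi_star (H i) (U i) \<inter> pi_star (H j) (U j) = {}) \<and>
        topological_group_iso G T (product_group I H) (product_topology U I))
      \<longrightarrow> lattice_iso (open_subgroup_lattice G T) (product_lattice I L))"
proof (intro conjI iffI impI)
  assume "lattice_iso (open_subgroup_lattice G T) (product_lattice I L)"
  then have iso: "order_iso (open_subgroup_lattice G T) (product_lattice I L)"
    using lattice_iso_iff_order_iso lattice_product_lattice[of I L] assms(3)
      topological_group.lattice_open_subgroups[OF profinite_group.axioms(1)[OF assms(1)]] by blast
  have L: "partial_order (L i)" if "i \<in> I" for i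
    using assms(3)[OF that] by (simp add: lattice_def upper_semilattice_def)
  obtain E where E: "\<And>i. i \<in> I \<Longrightarrow> subgroup (E i) G" "\<And>i. i \<in> I \<Longrightarrow> closedin T (E i)"
    "\<And>i. i \<in> I \<Longrightarrow> order_iso (open_subgroup_lattice (G\<lparr>carrier := E i\<rparr>) (subtopology T (E i))) (L i)"
    "\<And>i j. \<lbrakk>i \<in> I; j \<in> I; i \<noteq> j\<rbrakk> \<Longrightarrow> pi_star (G\<lparr>carrier := E i\<rparr>) (subtopology T (E i)) \<inter>
      pi_star (G\<lparr>carrier := E j\<rparr>) (subtopology T (E j)) = {}"
    "topological_group_iso G T (product_group I (\<lambda>i. G\<lparr>carrier := E i\<rparr>))
      (product_topology (\<lambda>i. subtopology T (E i)) I)"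
  proof (rule product_decomposition_if_order_iso[OF assms(1,2) _ iso])
    show "partial_order (L i)" if "i \<in> I" for i using L[OF that] .
  qed (rule that)
  \<comment> \<open>The factors are closed subgroups of \<open>G\<close>, which is why the type of
    \<open>G\<close> suffices for them.\<close>
  let ?H = "\<lambda>i. G\<lparr>carrier := E i\<rparr>" and ?U = "\<lambda>i. subtopology T (E i)"
  have "profinite_group (?H i) (?U i) \<and> lattice_iso (open_subgroup_lattice (?H i) (?U i)) (L i)"
    if i: "i \<in> I" for i
  proof
    show prof: "profinite_group (?H i) (?U i)"
      by (rule profinite_group.profinite_group_closed_subgroup[OF assms(1) E(1,2)[OF i]])
    show "lattice_iso (open_subgroup_lattice (?H i) (?U i)) (L i)"
      using lattice_iso_iff_order_iso assms(3)[OF i] E(3)[OF i]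
        topological_group.lattice_open_subgroups[OF profinite_group.axioms(1)[OF prof]] by blast
  qed
  then show "\<exists>(H :: 'i \<Rightarrow> 'a monoid) (U :: 'i \<Rightarrow> 'a topology).
        (\<forall>i\<in>I. profinite_group (H i) (U i) \<and>
               lattice_iso (open_subgroup_lattice (H i) (U i)) (L i)) \<and>
        (\<forall>i\<in>I. \<forall>j\<in>I. i \<noteq> j \<longrightarrow> pi_star (H i) (U i) \<inter> pi_star (H j) (U j) = {}) \<and>
        topological_group_iso G T (product_group I H) (product_topology U I)"
    using E(4,5) by (intro exI[of _ ?H] exI[of _ ?U] conjI ballI impI) simp_all
\<comment> \<open>The two remaining goals are the same implication, once over the type of
  \<open>G\<close> and once over \<open>'c\<close>.\<close>
qed (elim exE conjE, rule product_lattice_iso_if_decomposition[OF assms(1-3)]; assumption)+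

end
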